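(* Let initial data $\mathcal F_i^{(abs)},\mathcal F_i^{(scat)}$ satisfy conditions (i), (ii), (iii) below, and let $f$ be the corresponding solution of the Liouville equation on $\Gamma_{accr}$. Let $\gamma(t)=(t,r_*,\vartheta_*,\varphi_* )$, $r_*>2M_H$, be the world line of a static observer. Then for all $\alpha,\beta\in\{0,1,2,3\}$, $$\lim_{t\to\infty}J_\alpha(\gamma(t))=J_\alpha[f_{-\infty}],\qquad \lim_{t\to\infty}T_{\alpha\beta}(\gamma(t))=T_{\alpha\beta}[f_{-\infty}],$$ where $J_\alpha,T_{\alpha\beta}$ are the components of the current density and stress energy-momentum tensor of $f$ with respect to the frame $\{e_0,e_1,e_2,e_3\}$, and $J_\alpha[f_{-\infty}],T_{\alpha\beta}[f_{-\infty}]$ are the corresponding (time-independent) components at $(r_*,\vartheta_*,\varphi_* )$ of the observables of the stationary spherically symmetric distribution $f_{st}(x,p)=\delta(P_0(x,p)-m)f_{-\infty}(P_1(x,p)/m)$ on $\Gamma_{accr}$.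
   Context: Fix $M_H>0$ and particle mass $m>0$. Spacetime: coordinates $(t,r,\vartheta,\varphi)$, $r>0$, inverse metric $g^{-1}=-(1+\tfrac{2M_H}{r})\partial_t\otimes\partial_t+\tfrac{4M_H}{r}\partial_t\otimes_s\partial_r+(1-\tfrac{2M_H}{r})\partial_r\otimes\partial_r+\tfrac{1}{r^2}(\partial_\vartheta^2+\sin^{-2}\vartheta\,\partial_\varphi^2)$. On $T^*M$ with adapted coordinates $(x^\mu,p_\mu)$ set $P_0=\sqrt{-g^{\mu\nu}p_\mu p_\nu}$, $E=P_1=-p_t$, $\ell_z=P_2=p_\varphi$, $\ell=P_3=\sqrt{p_\vartheta^2+p_\varphi^2/\sin^2\vartheta}$. Dimensionless variables: $\tau=t/M_H$, $\xi=r/M_H$, $\pi_\xi=p_r/m$, $\pi_\vartheta=p_\vartheta/(M_Hm)$, $\varepsilon=E/m$, $\lambda=\ell/(M_Hm)$, $\lambda_z=\ell_z/(M_Hm)$. $U_\lambda(\xi)=(1-\tfrac2\xi)(1+\lambda^2/\xi^2)$; $\lambda_c(\varepsilon)$ ($\varepsilon>1$) is the $\lambda$ for which the maximum of $U_\lambda$ equals $\varepsilon^2$, $\lambda_c^2=12/(1-4\alpha-8\alpha^2+8\alpha\sqrt{\alpha^2+\alpha})$, $\alpha=\tfrac98\varepsilon^2-1$. $s=\sqrt{\varepsilon^2-U_\lambda(\xi)}$, $\pi_{\xi\pm}(\xi)=(\tfrac2\xi\varepsilon\pm s)/(1-\tfrac2\xi)$, $f_\pm(x)=(\tfrac2x s(x)\pm\varepsilon)/((1-\tfrac2x)s(x))$.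 $\Gamma_{accr}$: points of the future-directed timelike cotangent bundle with $\varepsilon>1$, $|\lambda_z|<\lambda$, and either (I) $\lambda<\lambda_c(\varepsilon)$, $\pi_\xi=\pi_{\xi-}(\xi)$ (absorbed), or (II) $\lambda>\lambda_c(\varepsilon)$, $\xi\ge\xi_0$, $\pi_\xi=\pi_{\xi\pm}(\xi)$, where $\xi_0$ is the turning point (root of $U_\lambda=\varepsilon^2$ beyond the maximum of $U_\lambda$) (scattered). Define $G=G_{\varepsilon,\lambda}(\xi,\pi_\xi)$ by $G=\int_2^\xi f_-(x)dx$ in case (I) (integrand extended continuously to $x=2$), and $G=\int_{\xi_0}^\xi f_\pm(x)dx$ for $\pi_\xi=\pi_{\xi\pm}$ in case (II). Define $Q^2=\varphi-\lambda_z\int_\gamma\frac{d\vartheta}{\pi_\vartheta\sin^2\vartheta}$ and $Q^3=-\lambda\int_{\xi_{ref}}^{\xi}\frac{dx}{x^2\sigma s(x)}+\lambda\int_\gamma\frac{d\vartheta}{\pi_\vartheta}$, with $\xi_{ref}=2$ (case I) or $\xi_0$ (case II), $\sigma=\pm1$ for $\pi_{\xi\pm}$, and $\gamma$ running clockwise along $\pi_\vartheta^2+\lambda_z^2/\sin^2\vartheta=\lambda^2$ from $(\pi/2,\sqrt{\lambda^2-\lambda_z^2})$ to $(\vartheta,\pi_\vartheta)$ ($Q^2,Q^3$ are defined modulo $2\pi$). Initial data: $R^{(abs)}=\{(G,Q^2,Q^3,\varepsilon,\lambda_z,\lambda):G\le0,\varepsilon>1,|\lambda_z|<\lambda<\lambda_c(\varepsilon)\}$,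 $R^{(scat)}=\{G\in\mathbb{R},\varepsilon>1,|\lambda_z|<\lambda,\lambda>\lambda_c(\varepsilon)\}$; the solution is $f(x,p)=\delta(P_0-m)\mathcal F_i^{(abs)}(G-\tau,Q^2,Q^3,\varepsilon,\lambda_z,\lambda)$ if $\lambda<\lambda_c(\varepsilon)$ and $\delta(P_0-m)\mathcal F_i^{(scat)}(G-\tau,\dots)$ if $\lambda>\lambda_c(\varepsilon)$, and $f=0$ outside $\Gamma_{accr}$. Conditions: (i) $\mathcal F_i^{(abs)},\mathcal F_i^{(scat)}$ are nonnegative, measurable, $2\pi$-periodic in $Q^2,Q^3$, and there are constants $C,b>0$ with $0\le\mathcal F_i^{(abs,scat)}\le Ce^{-b\varepsilon}$ everywhere on $R^{(abs,scat)}$. (ii) There is $f_{-\infty}:(1,\infty)\to\mathbb{R}$ with $\lim_{G\to-\infty}\mathcal F_i^{(abs)}(G,Q^2,Q^3,\varepsilon,\lambda_z,\lambda)=f_{-\infty}(\varepsilon)$ for all $Q^2,Q^3\in[0,2\pi]$, $\varepsilon>1$, $|\lambda_z|<\lambda<\lambda_c(\varepsilon)$. (iii) There is $f_{+\infty}:(1,\infty)\to\mathbb{R}$ such that for every $\varepsilon>1$, $\sup|\mathcal F_i^{(scat)}(G,Q^2,Q^3,\varepsilon,\lambda_z,\lambda)-f_{\pm\infty}(\varepsilon)|\to0$ as $G\to\pm\infty$, the supremum over $Q^2,Q^3\in[0,2\pi]$, $|\lambda_z|<\lambda$, $\lambda>\lambda_c(\varepsilon)$. Observables of a distribution $f$: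 $J(X)=\int_{T_x^*M}p(X)f\,\mathrm{dvol}_x$, $T(X,Y)=\int_{T_x^*M}p(X)p(Y)f\,\mathrm{dvol}_x$, $\mathrm{dvol}_x=\sqrt{-\det g^{\mu\nu}(x)}\,d^4p$. Frame (for $r>2M_H$, $N=1-2M_H/r$): $e_0=N^{-1/2}\partial_t$, $e_1=N^{-1/2}(\tfrac{2M_H}{r}\partial_t+N\partial_r)$, $e_2=r^{-1}\partial_\vartheta$, $e_3=(r\sin\vartheta)^{-1}\partial_\varphi$; $J_\alpha=J(e_\alpha)$, $T_{\alpha\beta}=T(e_\alpha,e_\beta)$. *)

theory Defs
  imports "HOL-Analysis.Analysis"
begin

definition Ulam :: "real \<Rightarrow> real \<Rightarrow> real" where
  "Ulam l x = (1 - 2 / x) * (1 + l\<^sup>2 / x\<^sup>2)"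

definition lam_c :: "real \<Rightarrow> real" where
  "lam_c e = (let a = 9/8 * e\<^sup>2 - 1 in
     sqrt (12 / (1 - 4*a - 8*a\<^sup>2 + 8 * a * sqrt (a\<^sup>2 + a))))"

definition sfun :: "real \<Rightarrow> real \<Rightarrow> real \<Rightarrow> real" where
  "sfun e l x = sqrt (e\<^sup>2 - Ulam l x)"

definition pixi :: "real \<Rightarrow> real \<Rightarrow> real \<Rightarrow> real \<Rightarrow> real" where
  "pixi sg e l x = (2 / x * e + sg * sfun e l x) / (1 - 2 / x)"

definition ffun :: "real \<Rightarrow> real \<Rightarrow> real \<Rightarrow> real \<Rightarrow> real" where
  "ffun sg e l x = (2 / x * sfun e l x + sg * e) / ((1 - 2 / x) * sfun e l x)"

text \<open>turning point: the largest root of U_l = e^2 (the one beyond the maximum of U_l)\<close>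
definition xi0 :: "real \<Rightarrow> real \<Rightarrow> real" where
  "xi0 e l = (GREATEST x. x > 0 \<and> Ulam l x = e\<^sup>2)"

definition G_abs :: "real \<Rightarrow> real \<Rightarrow> real \<Rightarrow> real" where
  "G_abs e l xi = (LBINT x=ereal 2..ereal xi. ffun (-1) e l x)"

definition G_scat :: "real \<Rightarrow> real \<Rightarrow> real \<Rightarrow> real \<Rightarrow> real" where
  "G_scat sg e l xi = (LBINT x=ereal (xi0 e l)..ereal xi. ffun sg e l x)"

definition radQ3 :: "real \<Rightarrow> real \<Rightarrow> real \<Rightarrow> real \<Rightarrow> real \<Rightarrow> real" where
  "radQ3 sg e l xiref xi = - l * (LBINT x=ereal xiref..ereal xi. 1 / (x\<^sup>2 * sg * sfun e l x))"

section \<open>Angular line integrals along the curve pth^2 + lz^2/sin^2 th = l^2\<close>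

definition ang_k :: "real \<Rightarrow> real \<Rightarrow> real" where
  "ang_k l lz = sqrt (1 - lz\<^sup>2 / l\<^sup>2)"

text \<open>clockwise parametrisation of the curve, starting at (pi/2, sqrt(l^2-lz^2)) for s = 0\<close>
definition th_c :: "real \<Rightarrow> real \<Rightarrow> real \<Rightarrow> real" where
  "th_c l lz s = arccos (- ang_k l lz * sin s)"

definition pth_c :: "real \<Rightarrow> real \<Rightarrow> real \<Rightarrow> real" where
  "pth_c l lz s = l * ang_k l lz * cos s / sin (th_c l lz s)"

definition s_par :: "real \<Rightarrow> real \<Rightarrow> real \<Rightarrow> real \<Rightarrow> real" where
  "s_par l lz th pth = (THE s. 0 \<le> s \<and> s < 2*pi \<and> th_c l lz s = th \<and> pth_c l lz s = pth)"

definition line_int :: "real \<Rightarrow> real \<Rightarrow> (real \<Rightarrow> real \<Rightarrow> real) \<Rightarrow> real \<Rightarrow> real \<Rightarrow> real" where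
  "line_int l lz a th pth =
     integral {0..s_par l lz th pth}
       (\<lambda>s. a (th_c l lz s) (pth_c l lz s) * deriv (th_c l lz) s)"

text \<open>momentum covector components (p_t, p_r, p_th, p_ph) are indices 0,1,2,3\<close>
definition mom :: "real \<Rightarrow> real \<Rightarrow> real \<Rightarrow> real \<Rightarrow> real^4" where
  "mom a0 a1 a2 a3 = (\<chi> i. if i = 0 then a0 else if i = 1 then a1 else if i = 2 then a2 else a3)"

definition ginv :: "real \<Rightarrow> real \<Rightarrow> real \<Rightarrow> real^4^4" where
  "ginv M r th = (\<chi> i j.
     if i = 0 \<and> j = 0 then - (1 + 2*M/r)
     else if (i = 0 \<and> j = 1) \<or> (i = 1 \<and> j = 0) then 2*M/r
     else if i = 1 \<and> j = 1 then 1 - 2*M/r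
     else if i = 2 \<and> j = 2 then 1 / r\<^sup>2
     else if i = 3 \<and> j = 3 then 1 / (r\<^sup>2 * (sin th)\<^sup>2)
     else 0)"

definition P0 :: "real \<Rightarrow> real \<Rightarrow> real \<Rightarrow> real^4 \<Rightarrow> real" where
  "P0 M r th p = sqrt (- (p \<bullet> (ginv M r th *v p)))"

definition fut_timelike :: "real \<Rightarrow> real \<Rightarrow> real \<Rightarrow> real^4 \<Rightarrow> bool" where
  "fut_timelike M r th p \<longleftrightarrow> p \<bullet> (ginv M r th *v p) < 0 \<and> (ginv M r th *v p) $ 0 > 0"

definition eps_of :: "real \<Rightarrow> real^4 \<Rightarrow> real" where
  "eps_of m p = - (p $ 0) / m"

definition lamz_of :: "real \<Rightarrow> real \<Rightarrow> real^4 \<Rightarrow> real" where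
  "lamz_of M m p = p $ 3 / (M * m)"

definition lam_of :: "real \<Rightarrow> real \<Rightarrow> real \<Rightarrow> real^4 \<Rightarrow> real" where
  "lam_of M m th p = sqrt ((p $ 2)\<^sup>2 + (p $ 3)\<^sup>2 / (sin th)\<^sup>2) / (M * m)"

definition pixi_of :: "real \<Rightarrow> real^4 \<Rightarrow> real" where
  "pixi_of m p = p $ 1 / m"

definition pith_of :: "real \<Rightarrow> real \<Rightarrow> real^4 \<Rightarrow> real" where
  "pith_of M m p = p $ 2 / (M * m)"

definition in_Gacc :: "real \<Rightarrow> real \<Rightarrow> real \<Rightarrow> real \<Rightarrow> real^4 \<Rightarrow> bool" where
  "in_Gacc M m r th p \<longleftrightarrow>
     (let e = eps_of m p; lz = lamz_of M m p; l = lam_of M m th p;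
          px = pixi_of m p; xi = r / M in
      fut_timelike M r th p \<and> e > 1 \<and> \<bar>lz\<bar> < l \<and>
      ((l < lam_c e \<and> px = pixi (-1) e l xi) \<or>
       (l > lam_c e \<and> xi \<ge> xi0 e l \<and> (px = pixi 1 e l xi \<or> px = pixi (-1) e l xi))))"

definition acc_vars :: "real \<Rightarrow> real \<Rightarrow> real \<Rightarrow> real \<Rightarrow> real \<Rightarrow> real^4 \<Rightarrow>
     real \<times> real \<times> real \<times> real \<times> real \<times> real" where
  "acc_vars M m r th ph p =
     (let e = eps_of m p; lz = lamz_of M m p; l = lam_of M m th p;
          px = pixi_of m p; pt = pith_of M m p; xi = r / M;
          absorbed = (l < lam_c e);
          sg = (if absorbed then -1 else if px = pixi 1 e l xi then 1 else -1);
          G = (if absorbed then G_abs e l xi else G_scat sg e l xi);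
          xiref = (if absorbed then 2 else xi0 e l);
          Q2 = ph - lz * line_int l lz (\<lambda>a b. 1 / (b * (sin a)\<^sup>2)) th pt;
          Q3 = radQ3 sg e l xiref xi + l * line_int l lz (\<lambda>a b. 1 / b) th pt
      in (G, Q2, Q3, e, lz, l))"

text \<open>the solution: f = delta(P0 - m) * fsol; fsol is the factor multiplying the delta\<close>
definition fsol :: "(real\<times>real\<times>real\<times>real\<times>real\<times>real \<Rightarrow> real) \<Rightarrow>
     (real\<times>real\<times>real\<times>real\<times>real\<times>real \<Rightarrow> real) \<Rightarrow>
     real \<Rightarrow> real \<Rightarrow> real \<Rightarrow> real \<Rightarrow> real \<Rightarrow> real \<Rightarrow> real^4 \<Rightarrow> real" where
  "fsol Fa Fs M m t r th ph p =
     (if in_Gacc M m r th p then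
        (case acc_vars M m r th ph p of (G, Q2, Q3, e, lz, l) \<Rightarrow>
          (if l < lam_c e then Fa (G - t / M, Q2, Q3, e, lz, l)
           else Fs (G - t / M, Q2, Q3, e, lz, l)))
      else 0)"

text \<open>the stationary distribution f_st = delta(P0 - m) * fstat\<close>
definition fstat :: "(real \<Rightarrow> real) \<Rightarrow> real \<Rightarrow> real \<Rightarrow> real \<Rightarrow> real \<Rightarrow> real^4 \<Rightarrow> real" where
  "fstat fm M m r th p = (if in_Gacc M m r th p then fm (eps_of m p) else 0)"

text \<open>integral over the fibre T*_x M of delta(P0 - m) * h with respect to
  sqrt(-det g^{mu nu}) d^4p, the delta being resolved in the p_t variable:
  delta(P0 - m) = sum over roots p_t of P0 = m of delta(p_t - root)/|d P0/d p_t|\<close>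
definition delta_int :: "real \<Rightarrow> real \<Rightarrow> real \<Rightarrow> real \<Rightarrow> (real^4 \<Rightarrow> real) \<Rightarrow> real" where
  "delta_int M m r th h =
     integral\<^sup>L (lborel :: (real \<times> real \<times> real) measure)
       (\<lambda>(a1, a2, a3). \<Sum>a0 \<in> {a0. P0 M r th (mom a0 a1 a2 a3) = m}.
           h (mom a0 a1 a2 a3) * sqrt (- det (ginv M r th))
           / \<bar>deriv (\<lambda>b. P0 M r th (mom b a1 a2 a3)) a0\<bar>)"

definition obsJ :: "(real^4 \<Rightarrow> real) \<Rightarrow> real \<Rightarrow> real \<Rightarrow> real \<Rightarrow> real \<Rightarrow> real^4 \<Rightarrow> real" where
  "obsJ f M m r th X = delta_int M m r th (\<lambda>p. (p \<bullet> X) * f p)"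

definition obsT :: "(real^4 \<Rightarrow> real) \<Rightarrow> real \<Rightarrow> real \<Rightarrow> real \<Rightarrow> real \<Rightarrow> real^4 \<Rightarrow> real^4 \<Rightarrow> real" where
  "obsT f M m r th X Y = delta_int M m r th (\<lambda>p. (p \<bullet> X) * (p \<bullet> Y) * f p)"

text \<open>the frame e_0..e_3 (components w.r.t. d_t, d_r, d_th, d_ph)\<close>
definition frame :: "real \<Rightarrow> real \<Rightarrow> real \<Rightarrow> 4 \<Rightarrow> real^4" where
  "frame M r th a = (let N = 1 - 2*M/r in
     if a = 0 then mom (1 / sqrt N) 0 0 0
     else if a = 1 then mom (2*M/r / sqrt N) (sqrt N) 0 0
     else if a = 2 then mom 0 0 (1 / r) 0
     else mom 0 0 0 (1 / (r * sin th)))"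

definition R_abs :: "(real\<times>real\<times>real\<times>real\<times>real\<times>real) set" where
  "R_abs = {(G, q2, q3, e, lz, l). G \<le> 0 \<and> e > 1 \<and> \<bar>lz\<bar> < l \<and> l < lam_c e}"

definition R_scat :: "(real\<times>real\<times>real\<times>real\<times>real\<times>real) set" where
  "R_scat = {(G, q2, q3, e, lz, l). e > 1 \<and> \<bar>lz\<bar> < l \<and> l > lam_c e}"

end

theory Submission
  imports Defs
begin

text \<open>
  For a fixed momentum in the accretion region the conserved quantities \<open>G, Q2, Q3, e, lz, l\<close> do not
  depend on \<open>t\<close>, so \<open>G - t / M\<close> tends to minus infinity and the integrand converges pointwise to
  that of the stationary distribution; dominated convergence does the rest. On the future mass shell
  the energy controls the whole momentum, so \<open>exp (- b * e)\<close> yields an integrable majorant.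
  Since the Bochner integral of a non-measurable function is \<open>0\<close>, Borel measurability of the solution in the
  momentum is essential: the turning point is measurable because the cubic whose largest root it is
  is convex and negative just below it, and the angular line integrals are rewritten as explicit
  functions and parametrised Lebesgue integrals. The data for absorbed orbits are controlled only
  for \<open>G \<le> 0\<close>; there \<open>Ulam l x < e\<^sup>2\<close> for all \<open>x > 2\<close> makes \<open>G_abs\<close> nonpositive.
\<close>

subsection \<open>Radial motion and the turning point\<close>

text \<open>
  With \<open>a = 9/8 * e\<^sup>2 - 1\<close> the substitution \<open>u = 1 - 2 * a + 2 * sqrt (a\<^sup>2 + a)\<close> rationalises
  \<open>lam_c\<close>; the maximum of the critical potential is then at \<open>6 / u\<close>.
\<close>
lemma lam_c_param:
  assumes "e > 1"
  obtains u where "1 < u" "u < 2" "lam_c e = sqrt (12 / (u * (2 - u)))"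
    "e\<^sup>2 - 1 = u * (2 * u - 3) / (9 * (2 - u))" 
proof -
  define a where "a = 9/8 * e\<^sup>2 - 1"
  define w where "w = sqrt (a\<^sup>2 + a)"
  define u where "u = 1 - 2 * a + 2 * w"
  have "e\<^sup>2 > 1" using assms by (simp add: one_less_power)
  then have a: "a > 1/8" by (simp add: a_def)
  have w2: "w\<^sup>2 = a\<^sup>2 + a" using a by (simp add: w_def)
  \<comment> \<open>The bounds \<open>a < w\<close> and \<open>w < a + 1/2\<close> are exactly what
    puts \<open>u\<close> strictly between 1 and 2.\<close>
  have "w > a" using a unfolding w_def by (intro real_less_rsqrt) auto
  moreover have "w < a + 1/2" unfolding w_def
    by (intro real_less_lsqrt) (use a in \<open>auto simp: power2_eq_square algebra_simps\<close>)
  ultimately have u: "1 < u" "u < 2" by (auto simp: u_def)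
  have "u * (2 - u) = 1 - 4 * a\<^sup>2 + 8 * a * w - 4 * w\<^sup>2"
    by (simp add: u_def power2_eq_square algebra_simps)
  then have "u * (2 - u) = 1 - 4*a - 8*a\<^sup>2 + 8 * a * w"
    unfolding w2 by simp
  then have 1: "lam_c e = sqrt (12 / (u * (2 - u)))"
    by (simp add: lam_c_def Let_def a_def w_def)
  \<comment> \<open>This relation is linear in \<open>a\<close> for given \<open>u\<close>, so it
    inverts the substitution and makes the energy rational in \<open>u\<close>.\<close>
  have "(u - 1)\<^sup>2 = 4 * a * (2 - u)"
    using w2 by (simp add: u_def power2_eq_square algebra_simps)
  then have "a = (u - 1)\<^sup>2 / (4 * (2 - u))" using u by (simp add: field_simps)
  moreover have "e\<^sup>2 - 1 = (8 * a - 1) / 9" by (simp add: a_def field_simps)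
  ultimately have "e\<^sup>2 - 1 = (8 * ((u - 1)\<^sup>2 / (4 * (2 - u))) - 1) / 9" by simp
  also have "\<dots> = u * (2 * u - 3) / (9 * (2 - u))"
    using u by (simp add: field_simps power2_eq_square)
  finally show ?thesis using that u 1 by blast
qed

section \<open>The cubic whose roots are the radial turning points\<close>

definition cubic :: "real \<Rightarrow> real \<Rightarrow> real \<Rightarrow> real" where
  "cubic e l x = (e\<^sup>2 - 1) * x^3 + 2 * x\<^sup>2 - l\<^sup>2 * x + 2 * l\<^sup>2"

lemma cubic_Ulam: "x > 0 \<Longrightarrow> e\<^sup>2 - Ulam l x = cubic e l x / x^3"
  by (simp add: Ulam_def cubic_def field_simps power2_eq_square power3_eq_cube)

text \<open>At the critical angular momentum the maximum of the potential touches the level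
  \<open>e\<^sup>2\<close>, which gives the cubic a double root \<open>a\<close>. The parameter
  \<open>l\<close> enters the cubic only through \<open>- l\<^sup>2 * (x - 2)\<close>, so the
  critical factorisation extends to every \<open>l\<close> with a correction proportional to
  \<open>x - 2\<close>.\<close>

lemma cubic_double_root:
  assumes "e > 1"
  obtains a k where "a > 3" "k > 0" "lam_c e > 0"
    "\<And>l x. cubic e l x = (x - a)\<^sup>2 * ((e\<^sup>2 - 1) * x + k) + ((lam_c e)\<^sup>2 - l\<^sup>2) * (x - 2)"
proof -
  obtain u where u: "1 < u" "u < 2" and lc: "lam_c e = sqrt (12 / (u * (2 - u)))"
    and e: "e\<^sup>2 - 1 = u * (2 * u - 3) / (9 * (2 - u))" by (rule lam_c_param[OF assms])
  have pos: "12 / (u * (2 - u)) > 0" using u by simp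
  define L where "L = 12 / (u * (2 - u))"
  \<comment> \<open>The value is forced by the constant coefficient:
    \<open>b\<^sup>2 * k = 2 * L\<close> at the double root \<open>b = 6 / u\<close>.\<close>
  define k where "k = 2 * u / (3 * (2 - u))"
  have L: "(lam_c e)\<^sup>2 = L" using pos by (simp add: lc L_def)
  have "cubic e l x = (x - 6/u)\<^sup>2 * ((e\<^sup>2 - 1) * x + k) + ((lam_c e)\<^sup>2 - l\<^sup>2) * (x - 2)" for l x
  proof -
    define q where "q = e\<^sup>2 - 1"
    define b where "b = 6 / u"
    have "k - 2 * b * q = 2" 
      using u by (simp add: b_def q_def e k_def) (simp add: divide_simps, simp add: algebra_simps)
    moreover have "b\<^sup>2 * q - 2 * b * k = - L"
      using u by (simp add: b_def q_def e k_def L_def) (simp add: divide_simps, simp add: algebra_simps power2_eq_square)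
    moreover have "b\<^sup>2 * k = 2 * L"
      using u by (simp add: b_def k_def L_def) (simp add: divide_simps, simp add: algebra_simps power2_eq_square)
    moreover have "(x - b)\<^sup>2 * (q * x + k) = q * x^3 + (k - 2 * b * q) * x\<^sup>2
        + (b\<^sup>2 * q - 2 * b * k) * x + b\<^sup>2 * k"
      by (simp add: algebra_simps power2_eq_square power3_eq_cube)
    ultimately have "(x - 6/u)\<^sup>2 * (q * x + k) = q * x^3 + 2 * x\<^sup>2 + (- L) * x + 2 * L"
      by (simp add: b_def)
    then show ?thesis unfolding cubic_def L q_def by (simp add: algebra_simps)
  qed
  moreover have "6/u > 3" "k > 0" using u by (auto simp: k_def field_simps)
  moreover have "lam_c e > 0" using pos by (simp add: lc)
  ultimately show ?thesis using that by blast
qed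

text \<open>In the double-root identity the first term is nonnegative and, below the critical
  angular momentum, the second is positive beyond the horizon. Absorbed orbits therefore meet no
  turning point there.\<close>

lemma Ulam_less_energy:
  assumes "e > 1" "0 < l" "l < lam_c e" "x > 2"
  shows "Ulam l x < e\<^sup>2"
proof -
  obtain a k where a: "a > 3" "k > 0" "lam_c e > 0" and c: "\<And>l x. cubic e l x = (x - a)\<^sup>2 * ((e\<^sup>2 - 1) * x + k) + ((lam_c e)\<^sup>2 - l\<^sup>2) * (x - 2)"
    by (rule cubic_double_root[OF assms(1)]) blast
  have "e\<^sup>2 > 1" using assms by (simp add: one_less_power)
  then have "(x - a)\<^sup>2 * ((e\<^sup>2 - 1) * x + k) \<ge> 0" using \<open>k > 0\<close> \<open>x > 2\<close> by simp
  moreover have "((lam_c e)\<^sup>2 - l\<^sup>2) * (x - 2) > 0"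
    using assms by (simp add: power_strict_mono)
  ultimately have "cubic e l x > 0" by (simp add: c)
  then have "e\<^sup>2 - Ulam l x > 0" using assms by (simp add: cubic_Ulam)
  then show ?thesis by simp
qed

text \<open>At the double root only the correction term survives, and it is negative above the
  critical angular momentum: the potential barrier exceeds the energy there.\<close>

lemma cubic_neg_above_lam_c:
  assumes "e > 1" "l > lam_c e"
  obtains a where "a > 3" "cubic e l a < 0"
proof -
  obtain a k where a: "a > 3" "k > 0" "lam_c e > 0" and c: "\<And>l x. cubic e l x = (x - a)\<^sup>2 * ((e\<^sup>2 - 1) * x + k) + ((lam_c e)\<^sup>2 - l\<^sup>2) * (x - 2)"
    by (rule cubic_double_root[OF assms(1)]) blast
  have "(lam_c e)\<^sup>2 < l\<^sup>2" using assms a by (intro power_strict_mono) auto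
  then have "cubic e l a < 0" using a by (simp add: c mult_neg_pos)
  then show ?thesis using that a by blast
qed

text \<open>Beyond the horizon the potential is nonnegative, so \<open>sfun e l x \<le> e\<close>;
  with \<open>2 / x < 1\<close> this makes the numerator of the integrand nonpositive.\<close>

lemma G_abs_nonpos:
  assumes "e > 1" "0 < l" "l < lam_c e" "xi > 2"
  shows "G_abs e l xi \<le> 0"
proof -
  have "ffun (-1) e l x \<le> 0" if x: "x > 2" for x
  proof -
    have U: "Ulam l x < e\<^sup>2" using Ulam_less_energy assms x by blast
    have "Ulam l x \<ge> 0" using x unfolding Ulam_def by (intro mult_nonneg_nonneg) auto
    then have "sqrt (e\<^sup>2 - Ulam l x) \<le> sqrt (e\<^sup>2)" by (intro real_sqrt_le_mono) auto
    then have s: "0 \<le> sfun e l x" "sfun e l x \<le> e" using U assms by (auto simp: sfun_def)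
    have "2 / x * sfun e l x \<le> 1 * sfun e l x" using x s by (intro mult_right_mono) auto
    then show ?thesis unfolding ffun_def using x s
      by (intro divide_nonpos_nonneg mult_nonneg_nonneg) auto
  qed
  \<comment> \<open>The Bochner integral of a nonnegative function is nonnegative whether or not the
    function is integrable, so the sign is settled on the integrand alone.\<close>
  then have "(LBINT x:einterval (ereal 2) (ereal xi). - ffun (-1) e l x) \<ge> 0"
    unfolding set_lebesgue_integral_def
    by (intro integral_nonneg_AE AE_I2) (auto simp: indicator_def einterval_def)
  then show ?thesis using assms
    by (simp add: G_abs_def interval_lebesgue_integral_def set_lebesgue_integral_def)
qed

text \<open>The second claim turns a superlevel set of the turning point into a countable union of
  polynomial conditions, which is what measurability needs. A negative value of the cubic forces a
  larger root by the intermediate value theorem; conversely, convexity keeps the cubic negative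
  between a known negative point and the largest root.\<close>

lemma
  assumes "e > 1" "l > lam_c e"
  shows xi0_pos: "xi0 e l > 0"
    and xi0_greater_iff: "y \<ge> 0 \<Longrightarrow> xi0 e l > y \<longleftrightarrow> (\<exists>q\<in>\<rat>. q > y \<and> cubic e l q < 0)"
proof -
  have e2: "e\<^sup>2 > 1" using assms by (simp add: one_less_power)
  obtain a where a: "a > 3" "cubic e l a < 0"
    using cubic_neg_above_lam_c assms by blast
  have root_iff: "Ulam l x = e\<^sup>2 \<longleftrightarrow> cubic e l x = 0" if "x > 0" for x
    using cubic_Ulam[OF that, of e l] that by auto
  have cont: "continuous_on A (cubic e l)" for A
    unfolding cubic_def by (intro continuous_intros)
  have root: "\<exists>x>q. cubic e l x = 0" if q: "cubic e l q < 0" for q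
  proof -
    \<comment> \<open>A point beyond \<open>q\<close> and so large that the cubic term dominates
      \<open>l\<^sup>2 * z\<close>; the summand 1 ensures \<open>z \<ge> 1\<close>, hence
      \<open>z \<le> z\<^sup>2\<close>.\<close>
    define z where "z = max (q + 1) (1 + l\<^sup>2 / (e\<^sup>2 - 1))"
    have z1: "z \<ge> 1" "z > q" using e2 by (auto simp: z_def le_max_iff_disj)
    have "l\<^sup>2 / (e\<^sup>2 - 1) \<le> z" by (simp add: z_def)
    also have "z \<le> z\<^sup>2" using z1 by (simp add: power2_eq_square)
    finally have "l\<^sup>2 \<le> (e\<^sup>2 - 1) * z\<^sup>2" using e2 by (simp add: field_simps)
    then have "l\<^sup>2 * z \<le> (e\<^sup>2 - 1) * z\<^sup>2 * z" using z1 by (intro mult_right_mono) auto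
    moreover have "cubic e l z = ((e\<^sup>2 - 1) * z\<^sup>2 * z - l\<^sup>2 * z) + 2 * z\<^sup>2 + 2 * l\<^sup>2"
      by (simp add: cubic_def power2_eq_square power3_eq_cube)
    ultimately have "cubic e l z > 0" using z1
      by (simp add: add_nonneg_pos add_pos_nonneg)
    with z1 have z: "cubic e l z > 0" "z > q" by auto
    then obtain x where "q \<le> x" "x \<le> z" "cubic e l x = 0"
      using IVT'[of "cubic e l" q 0 z] q z cont by fastforce
    then show ?thesis using q by (intro exI[of _ x]) (auto simp: less_le)
  qed
  define R where "R = {x. x > 0 \<and> cubic e l x = 0}"
  \<comment> \<open>A nonzero polynomial has finitely many roots, so \<open>Max R\<close> exists and
    is the value that \<open>GREATEST\<close> selects.\<close>
  define p where "p = [:2 * l\<^sup>2, - l\<^sup>2, 2, e\<^sup>2 - 1:]"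
  have "cubic e l x = poly p x" for x
    by (simp add: p_def cubic_def algebra_simps power2_eq_square power3_eq_cube)
  moreover have "p \<noteq> 0" using e2 by (simp add: p_def)
  ultimately have fin: "finite R"
    using finite_subset[OF _ poly_roots_finite[of p], of R] by (auto simp: R_def)
  obtain x where "x > a" "cubic e l x = 0" using root a by blast
  then have xR: "x \<in> R" "x > a" using a by (auto simp: R_def)
  have xi: "xi0 e l = Max R"
    unfolding xi0_def
  proof (rule Greatest_equality)
    show "0 < Max R \<and> Ulam l (Max R) = e\<^sup>2"
      using Max_in[of R] fin xR root_iff by (auto simp: R_def)
    show "y \<le> Max R" if "0 < y \<and> Ulam l y = e\<^sup>2" for y
      using that fin root_iff by (intro Max_ge) (auto simp: R_def)
  qed
  define z where "z = xi0 e l"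
  have "z \<ge> x" using Max_ge[OF fin xR(1)] by (simp add: z_def xi)
  then have "z > a" using xR by simp
  then show "xi0 e l > 0" using a by (simp add: z_def)
  assume "y \<ge> 0"
  show "xi0 e l > y \<longleftrightarrow> (\<exists>q\<in>\<rat>. q > y \<and> cubic e l q < 0)"
  proof
    assume "\<exists>q\<in>\<rat>. q > y \<and> cubic e l q < 0"
    then obtain q x where "q > y" "x > q" "cubic e l x = 0" using root by blast
    then have "x \<in> R" "x > y" using \<open>y \<ge> 0\<close> by (auto simp: R_def)
    then show "xi0 e l > y" unfolding xi using fin Max_ge[of R x] by linarith
  next
    assume y: "xi0 e l > y"
    obtain q where q: "q \<in> \<rat>" "max y a < q" "q < z"
      using Rats_dense_in_real[of "max y a" z] y \<open>z > a\<close> by (auto simp: z_def)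
    have z0: "cubic e l z = 0" using Max_in[of R] fin xR by (auto simp: R_def z_def xi)
    \<comment> \<open>The graph lies below the chord from \<open>a\<close>, where the cubic is
      negative, to \<open>z\<close>, where it vanishes; the chord is negative before
      \<open>z\<close>.\<close>
    have "convex_on {0..} (cubic e l)"
    proof (rule f''_ge0_imp_convex)
      show "(cubic e l has_real_derivative 3 * (e\<^sup>2 - 1) * x\<^sup>2 + 4 * x - l\<^sup>2) (at x)" for x
        unfolding cubic_def by (auto intro!: derivative_eq_intros)
      show "((\<lambda>x. 3 * (e\<^sup>2 - 1) * x\<^sup>2 + 4 * x - l\<^sup>2) has_real_derivative 6 * (e\<^sup>2 - 1) * x + 4) (at x)" for x
        by (auto intro!: derivative_eq_intros)
    qed (use e2 in auto)
    then have "cubic e l q \<le> (cubic e l z - cubic e l a) / (z - a) * (q - a) + cubic e l a"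
      using q a by (intro convex_onD_Icc') (auto intro: convex_on_subset)
    also have "\<dots> = cubic e l a * ((z - q) / (z - a))"
      using \<open>z > a\<close> z0 by (simp add: field_simps)
    also have "\<dots> < 0" using a q by (intro mult_neg_pos) auto
    finally show "\<exists>q\<in>\<rat>. q > y \<and> cubic e l q < 0" using q by auto
  qed
qed

subsection \<open>Angular line integrals\<close>

text \<open>\<open>ang_k l lz\<close> is the sine of the inclination of the orbital plane. It
  reaches 1 only for \<open>lz = 0\<close>, when the orbit runs through the poles.\<close>

lemma ang_k_bounds:
  assumes "\<bar>lz\<bar> < l"
  shows "0 < ang_k l lz" "ang_k l lz \<le> 1" "lz \<noteq> 0 \<Longrightarrow> ang_k l lz < 1"
    "l\<^sup>2 * (ang_k l lz)\<^sup>2 = l\<^sup>2 - lz\<^sup>2"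
proof -
  have l: "l > 0" using assms by linarith
  have "lz\<^sup>2 < l\<^sup>2" using assms by (simp add: abs_le_square_iff[symmetric] linorder_not_le[symmetric])
  then have lt: "lz\<^sup>2 / l\<^sup>2 < 1" using l by (simp add: field_simps)
  then show "0 < ang_k l lz" "ang_k l lz \<le> 1" "lz \<noteq> 0 \<Longrightarrow> ang_k l lz < 1"
    using l by (auto simp: ang_k_def)
  have "(ang_k l lz)\<^sup>2 = 1 - lz\<^sup>2 / l\<^sup>2" using lt by (simp add: ang_k_def)
  then show "l\<^sup>2 * (ang_k l lz)\<^sup>2 = l\<^sup>2 - lz\<^sup>2" using l by (simp add: field_simps)
qed

lemma abs_mult_sin_le: "0 < k \<Longrightarrow> k \<le> 1 \<Longrightarrow> \<bar>k * sin s\<bar> \<le> 1" for k s :: real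
  using mult_mono[of k 1 "\<bar>sin s\<bar>" 1] by (simp add: abs_mult)

text \<open>Explicit inverse of the clockwise parametrisation: the arccosine recovers the parameter
  from its cosine, and the sign of \<open>cos th\<close>, opposite to that of its sine, selects the
  half turn. Clamping the argument to the interval from -1 to 1 keeps the expression continuous off
  the curve.\<close>

definition ang_par :: "real \<Rightarrow> real \<Rightarrow> real \<Rightarrow> real \<Rightarrow> real" where
  "ang_par l lz th pth =
     (let a = arccos (max (-1) (min 1 (pth * sin th / (l * ang_k l lz))))
      in if cos th \<le> 0 then a else 2 * pi - a)"

lemma sin_cos_inj_2pi:
  fixes s t :: real
  assumes "0 \<le> s" "s < 2 * pi" "0 \<le> t" "t < 2 * pi" "sin s = sin t" "cos s = cos t"
  shows "s = t"
proof -
  have *: "sin s = sin t \<and> cos s = cos t" using assms by simp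
  then obtain n :: int where n: "s = t + 2 * pi * n"
    unfolding sin_cos_eq_iff by blast
  have "2 * pi * n < 2 * pi * 1" "2 * pi * (-1) < 2 * pi * n" using n assms by linarith+
  then have "real_of_int n < 1" "-1 < real_of_int n" by (simp_all only: mult_less_cancel_left_pos pi_gt_zero zero_less_mult_iff zero_less_numeral simp_thms)
  then have "n = 0" by linarith
  with n show ?thesis by simp
qed

text \<open>On the curve the pair \<open>(c, d)\<close> lies on the unit circle, and being at
  \<open>(th, pth)\<close> means having cosine \<open>c\<close> and sine \<open>d\<close>. The
  parameter is thus the polar angle of that pair, unique in one turn, so the description by
  \<open>THE\<close> is proper.\<close>

lemma s_par_eq:
  assumes "0 < th" "th < pi" "\<bar>lz\<bar> < l" "l\<^sup>2 = pth\<^sup>2 + lz\<^sup>2 / (sin th)\<^sup>2"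
  shows "s_par l lz th pth = ang_par l lz th pth"
    and "0 \<le> s_par l lz th pth" "s_par l lz th pth < 2 * pi"
proof -
  define k where "k = ang_k l lz"
  have k: "0 < k" "k \<le> 1" and lk: "l\<^sup>2 * k\<^sup>2 = l\<^sup>2 - lz\<^sup>2"
    using ang_k_bounds[OF assms(3)] by (auto simp: k_def)
  have l: "l > 0" using assms by linarith
  have st: "sin th > 0" using assms sin_gt_zero by blast
  define c where "c = pth * sin th / (l * k)"
  define d where "d = - cos th / k"
  have "l\<^sup>2 * (sin th)\<^sup>2 = pth\<^sup>2 * (sin th)\<^sup>2 + lz\<^sup>2"
    using assms(4) st by (simp add: field_simps)
  \<comment> \<open>The curve equation, cleared of its denominator, becomes the circle equation for
    \<open>(c, d)\<close> after division by \<open>l\<^sup>2 * k\<^sup>2\<close>.\<close>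
  then have "pth\<^sup>2 * (sin th)\<^sup>2 + l\<^sup>2 * (cos th)\<^sup>2 = l\<^sup>2 * k\<^sup>2"
    unfolding lk cos_squared_eq by (simp add: algebra_simps)
  then have cd: "c\<^sup>2 + d\<^sup>2 = 1"
    using k l by (simp add: c_def d_def power_divide power_mult_distrib field_simps)
  then obtain s where s: "0 \<le> s" "s < 2 * pi" "c = cos s" "d = sin s"
    using sincos_total_2pi[of c d] by blast
  have th_iff: "th_c l lz t = th \<longleftrightarrow> sin t = d" for t
  proof
    assume "th_c l lz t = th"
    then have "cos th = - k * sin t" using abs_mult_sin_le[OF k, of t]
      by (auto simp: th_c_def k_def[symmetric] abs_le_iff intro!: cos_arccos)
    then show "sin t = d" using k by (simp add: d_def)
  next
    assume "sin t = d"
    then show "th_c l lz t = th" using k assms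
      by (simp add: th_c_def k_def[symmetric] d_def arccos_cos)
  qed
  have par_iff: "th_c l lz t = th \<and> pth_c l lz t = pth \<longleftrightarrow> sin t = d \<and> cos t = c" for t
    unfolding th_iff[symmetric] using k l st
    by (auto simp: pth_c_def k_def[symmetric] c_def)
  have "s_par l lz th pth = s"
    unfolding s_par_def using s sin_cos_inj_2pi[of _ s]
    by (intro the_equality) (auto simp: par_iff)
  moreover have "ang_par l lz th pth = s"
  proof (cases "s \<le> pi")
    case True
    then have "d \<ge> 0" using s sin_ge_zero by auto
    then have "cos th \<le> 0" using k by (simp add: d_def field_simps)
    then show ?thesis using s True by (simp add: ang_par_def Let_def k_def[symmetric] c_def[symmetric] arccos_cos)
  next
    case False
    then have "d < 0" using s sin_lt_zero by auto
    then have "cos th > 0" using k by (simp add: d_def field_simps)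
    moreover have "cos s = cos (2 * pi - s)" by (simp add: cos_diff)
    moreover have "arccos (cos (2 * pi - s)) = 2 * pi - s" using False s by (intro arccos_cos) auto
    ultimately show ?thesis using s False by (simp add: ang_par_def Let_def k_def[symmetric] c_def[symmetric])
  qed
  ultimately show "s_par l lz th pth = ang_par l lz th pth"
    "0 \<le> s_par l lz th pth" "s_par l lz th pth < 2 * pi" using s by auto
qed

text \<open>Where \<open>cos s\<close> vanishes the momentum on the curve is zero, so the line
  integrands divide by zero, and for \<open>lz = 0\<close> the arccosine is not differentiable.
  These parameters can be discarded because they form a null set.\<close>

lemma negligible_cos_zeros: "negligible {s::real. cos s = 0}"
proof -
  have "{s::real. cos s = 0} \<subseteq> range (\<lambda>i::int. of_int i * (pi / 2))"
    by (auto simp: cos_zero_iff_int)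
  then show ?thesis unfolding negligible_iff_null_sets
    by (intro null_sets_completionI countable_imp_null_set_lborel) (rule countable_subset, auto)
qed

text \<open>For \<open>cos s \<noteq> 0\<close> the argument of the arccosine is strictly inside its
  domain, even when \<open>ang_k l lz = 1\<close>, so the chain rule applies.\<close>

lemma
  assumes "\<bar>lz\<bar> < l" "cos s \<noteq> 0"
  shows deriv_th_c: "deriv (th_c l lz) s = ang_k l lz * cos s / sin (th_c l lz s)"
    and sin_th_c_squared: "(sin (th_c l lz s))\<^sup>2 = 1 - (ang_k l lz)\<^sup>2 * (sin s)\<^sup>2"
    and sin_th_c_pos: "sin (th_c l lz s) > 0"
proof -
  define k where "k = ang_k l lz"
  have k: "0 < k" "k \<le> 1" using ang_k_bounds[OF assms(1)] by (auto simp: k_def)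
  have "(sin s)\<^sup>2 < 1" using assms(2) by (simp add: sin_squared_eq)
  then have "\<bar>sin s\<bar> < 1" by (simp add: abs_square_less_1)
  then have "\<bar>k * sin s\<bar> < 1" using k mult_le_less_imp_less[of k 1 "\<bar>sin s\<bar>" 1]
    by (cases "sin s = 0") (auto simp: abs_mult)
  then have b: "-1 < - k * sin s" "- k * sin s < 1" and lt: "(k * sin s)\<^sup>2 < 1"
    by (auto simp: abs_square_less_1)
  have sq: "sin (th_c l lz s) = sqrt (1 - (k * sin s)\<^sup>2)"
    using b by (simp add: th_c_def k_def[symmetric] sin_arccos)
  have "(th_c l lz has_real_derivative inverse (- sqrt (1 - (- k * sin s)\<^sup>2)) * (- k * cos s)) (at s)"
    unfolding th_c_def k_def[symmetric]
    by (rule DERIV_chain2[where f = arccos and g = "\<lambda>s. - k * sin s", OF DERIV_arccos[OF b]]) (auto intro!: derivative_eq_intros)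
  then have "deriv (th_c l lz) s = inverse (- sqrt (1 - (- k * sin s)\<^sup>2)) * (- k * cos s)"
    by (rule DERIV_imp_deriv)
  then show "deriv (th_c l lz) s = ang_k l lz * cos s / sin (th_c l lz s)"
    unfolding sq by (simp add: k_def[symmetric] divide_inverse)
  show "(sin (th_c l lz s))\<^sup>2 = 1 - (ang_k l lz)\<^sup>2 * (sin s)\<^sup>2" "sin (th_c l lz s) > 0"
    unfolding sq using lt by (auto simp: k_def[symmetric] power_mult_distrib)
qed

text \<open>The velocity of the polar angle is the momentum divided by \<open>l\<close>, so the
  pulled-back integrand is the constant \<open>1 / l\<close> off a null set.\<close>

lemma line_int_inverse_momentum:
  assumes "0 < th" "th < pi" "\<bar>lz\<bar> < l" "l\<^sup>2 = pth\<^sup>2 + lz\<^sup>2 / (sin th)\<^sup>2"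
  shows "l * line_int l lz (\<lambda>a b. 1 / b) th pth = ang_par l lz th pth"
proof -
  have l: "l > 0" using assms by linarith
  define S where "S = s_par l lz th pth"
  have S: "S = ang_par l lz th pth" "S \<ge> 0" using s_par_eq[OF assms] by (auto simp: S_def)
  have "line_int l lz (\<lambda>a b. 1 / b) th pth = integral {0..S} (\<lambda>s. 1 / l)"
    unfolding line_int_def S_def[symmetric]
  proof (rule integral_spike[OF negligible_cos_zeros])
    fix s assume "s \<in> {0..S} - {s. cos s = 0}"
    then have c: "cos s \<noteq> 0" by auto
    show "1 / l = 1 / pth_c l lz s * deriv (th_c l lz) s"
      using deriv_th_c[OF assms(3) c] sin_th_c_pos[OF assms(3) c] ang_k_bounds(1)[OF assms(3)] l c
      by (simp add: pth_c_def)
  qed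
  also have "\<dots> = S / l" using S by simp
  finally show ?thesis using S l by simp
qed

text \<open>Pullback of the azimuthal line integral to the curve parameter. A Lebesgue integral
  replaces the gauge integral so that measurability in the limit and the parameters becomes
  accessible.\<close>

definition azimuth_int :: "real \<Rightarrow> real \<Rightarrow> real \<Rightarrow> real" where
  "azimuth_int l lz S = (LBINT s=ereal 0..ereal S. 1 / (l * (1 - (ang_k l lz)\<^sup>2 * (sin s)\<^sup>2)))"

text \<open>The factor \<open>lz\<close> is needed: for \<open>lz = 0\<close> the curve meets the poles and the integrand blows up.\<close>
lemma line_int_azimuth:
  assumes "0 < th" "th < pi" "\<bar>lz\<bar> < l" "l\<^sup>2 = pth\<^sup>2 + lz\<^sup>2 / (sin th)\<^sup>2"
  shows "lz * line_int l lz (\<lambda>a b. 1 / (b * (sin a)\<^sup>2)) th pth = lz * azimuth_int l lz (ang_par l lz th pth)"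
proof (cases "lz = 0")
  case False
  define k where "k = ang_k l lz"
  have k: "0 < k" "k < 1" using ang_k_bounds[OF assms(3)] False by (auto simp: k_def)
  have l: "l > 0" using assms by linarith
  define S where "S = s_par l lz th pth"
  have S: "S = ang_par l lz th pth" "S \<ge> 0" using s_par_eq[OF assms] by (auto simp: S_def)
  define g where "g = (\<lambda>s. 1 / (l * (1 - k\<^sup>2 * (sin s)\<^sup>2)))"
  have "line_int l lz (\<lambda>a b. 1 / (b * (sin a)\<^sup>2)) th pth = integral {0..S} g"
    unfolding line_int_def S_def[symmetric]
  proof (rule integral_spike[OF negligible_cos_zeros])
    fix s assume "s \<in> {0..S} - {s. cos s = 0}"
    then have c: "cos s \<noteq> 0" by auto
    show "g s = 1 / (pth_c l lz s * (sin (th_c l lz s))\<^sup>2) * deriv (th_c l lz) s"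
      unfolding sin_th_c_squared[OF assms(3) c]
      using deriv_th_c[OF assms(3) c] sin_th_c_pos[OF assms(3) c] k l c
      by (simp add: pth_c_def g_def k_def[symmetric])
  qed
  also have "\<dots> = (LBINT s=ereal 0..ereal S. g s)"
  proof -
    \<comment> \<open>Since \<open>k < 1\<close> the curve avoids the poles and the denominator
      never vanishes; continuity then makes the two notions of integral agree.\<close>
    have "k\<^sup>2 * (sin s)\<^sup>2 \<le> k\<^sup>2 * 1" for s
      by (intro mult_left_mono) (auto simp: abs_square_le_1)
    moreover have "k\<^sup>2 < 1" using k by (simp add: power_less_one_iff)
    ultimately have "k\<^sup>2 * (sin s)\<^sup>2 < 1" for s using le_less_trans by fastforce
    then have nz: "1 - k\<^sup>2 * (sin s)\<^sup>2 \<noteq> 0" for s by (metis eq_iff_diff_eq_0 less_irrefl)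
    have "continuous_on {0..S} g" unfolding g_def using l nz by (intro continuous_intros) auto
    then show ?thesis
      using S by (intro interval_integral_eq_integral[symmetric] borel_integrable_atLeastAtMost') auto
  qed
  finally show ?thesis by (simp add: azimuth_int_def g_def k_def S)
qed simp

subsection \<open>Measurability of the orbit variables\<close>

text \<open>The variable limits are moved into the integrand as a jointly measurable cut-off, with a
  sign for reversed limits; what remains is a parametrised integral over the whole line.\<close>

lemma borel_measurable_LBINT_param:
  assumes [measurable]: "a \<in> borel_measurable N" "b \<in> borel_measurable N"
    "(\<lambda>(p, y). F p y) \<in> borel_measurable (N \<Otimes>\<^sub>M borel)"
  shows "(\<lambda>p. LBINT y=ereal (a p)..ereal (b p). F p y) \<in> borel_measurable N"
proof -
  have [measurable]: "(\<lambda>(p, y). F p y) \<in> borel_measurable (N \<Otimes>\<^sub>M lborel)"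
    using assms(3) by (simp add: measurable_lborel1 cong: measurable_cong_sets sets_pair_measure_cong)
  have "(\<lambda>(p, y). if a p < y \<and> y < b p then F p y else 0) \<in> borel_measurable (N \<Otimes>\<^sub>M lborel)"
    "(\<lambda>(p, y). if b p < y \<and> y < a p then F p y else 0) \<in> borel_measurable (N \<Otimes>\<^sub>M lborel)"
    by measurable
  note this[THEN lborel.borel_measurable_lebesgue_integral, measurable]
  have "(LBINT y=ereal (a p)..ereal (b p). F p y) =
      (if a p \<le> b p then LBINT y. (if a p < y \<and> y < b p then F p y else 0)
       else - (LBINT y. if b p < y \<and> y < a p then F p y else 0))" for p
    unfolding interval_lebesgue_integral_def set_lebesgue_integral_def
    by (auto simp: einterval_def indicator_def intro!: Bochner_Integration.integral_cong)
  then show ?thesis by simp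
qed

lemma borel_measurable_lam_c [measurable]: "lam_c \<in> borel_measurable borel"
  unfolding lam_c_def Let_def by measurable

lemma borel_measurable_sfun [measurable (raw)]:
  assumes [measurable]: "e \<in> borel_measurable N" "l \<in> borel_measurable N" "x \<in> borel_measurable N"
  shows "(\<lambda>p. sfun (e p) (l p) (x p)) \<in> borel_measurable N"
  unfolding sfun_def Ulam_def by measurable

lemma borel_measurable_pixi [measurable (raw)]:
  assumes [measurable]: "e \<in> borel_measurable N" "l \<in> borel_measurable N" "x \<in> borel_measurable N"
  shows "(\<lambda>p. pixi sg (e p) (l p) (x p)) \<in> borel_measurable N"
  unfolding pixi_def by measurable

lemma borel_measurable_ffun [measurable (raw)]:
  assumes [measurable]: "e \<in> borel_measurable N" "l \<in> borel_measurable N" "x \<in> borel_measurable N"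
  shows "(\<lambda>p. ffun sg (e p) (l p) (x p)) \<in> borel_measurable N"
  unfolding ffun_def by measurable

text \<open>
  Outside the scattering region \<open>xi0\<close> may be a junk value of \<open>GREATEST\<close>, so it is cut off there.
\<close>
definition xi0_scat :: "real \<Rightarrow> real \<Rightarrow> real" where
  "xi0_scat e l = (if e > 1 \<and> l > lam_c e then xi0 e l else 0)"

lemma borel_measurable_xi0_scat_pair: "(\<lambda>(e, l). xi0_scat e l) \<in> borel_measurable (borel \<Otimes>\<^sub>M borel)"
proof (rule borel_measurable_iff_greater[THEN iffD2], rule allI)
  fix y :: real
  \<comment> \<open>Negative levels are always exceeded, since the cut-off value is 0 and a genuine
    turning point is positive; other levels fall under the rational criterion.\<close>
  have "(case z of (e, l) \<Rightarrow> xi0_scat e l) > y \<longleftrightarrow>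
      (if y < 0 then True else
        fst z > 1 \<and> snd z > lam_c (fst z) \<and> (\<exists>q\<in>\<rat>. q > y \<and> cubic (fst z) (snd z) q < 0))" for z
    using xi0_greater_iff[of "fst z" "snd z" y] xi0_pos[of "fst z" "snd z"]
    by (cases z) (auto simp: xi0_scat_def)
  then have "{z \<in> space (borel \<Otimes>\<^sub>M borel). y < (case z of (e, l) \<Rightarrow> xi0_scat e l)} =
    {z \<in> space (borel \<Otimes>\<^sub>M borel). if y < 0 then True else
        fst z > 1 \<and> snd z > lam_c (fst z) \<and> (\<exists>q\<in>\<rat>. q > y \<and> cubic (fst z) (snd z) q < 0)}"
    by auto
  also have "\<dots> \<in> sets (borel \<Otimes>\<^sub>M borel)"
    unfolding cubic_def using countable_rat by measurable
  finally show "{z \<in> space (borel \<Otimes>\<^sub>M borel). y < (case z of (e, l) \<Rightarrow> xi0_scat e l)} \<in> sets (borel \<Otimes>\<^sub>M borel)" .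
qed

lemma borel_measurable_xi0_scat [measurable (raw)]:
  assumes [measurable]: "e \<in> borel_measurable N" "l \<in> borel_measurable N"
  shows "(\<lambda>p. xi0_scat (e p) (l p)) \<in> borel_measurable N"
  using measurable_compose[OF measurable_Pair[OF assms] borel_measurable_xi0_scat_pair] by simp

lemma borel_measurable_ang_k [measurable (raw)]:
  assumes [measurable]: "l \<in> borel_measurable N" "lz \<in> borel_measurable N"
  shows "(\<lambda>p. ang_k (l p) (lz p)) \<in> borel_measurable N"
  unfolding ang_k_def by measurable

lemma borel_measurable_ang_par [measurable (raw)]:
  assumes [measurable]: "l \<in> borel_measurable N" "lz \<in> borel_measurable N" "pt \<in> borel_measurable N"
  shows "(\<lambda>p. ang_par (l p) (lz p) th (pt p)) \<in> borel_measurable N"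
proof -
  have "continuous_on UNIV (\<lambda>x::real. arccos (max (-1) (min 1 x)))"
    by (intro continuous_intros) auto
  then have [measurable]: "(\<lambda>x::real. arccos (max (-1) (min 1 x))) \<in> borel_measurable borel"
    by (rule borel_measurable_continuous_onI)
  show ?thesis unfolding ang_par_def Let_def by measurable
qed

lemma borel_measurable_azimuth_int [measurable (raw)]:
  assumes [measurable]: "l \<in> borel_measurable N" "lz \<in> borel_measurable N" "S \<in> borel_measurable N"
  shows "(\<lambda>p. azimuth_int (l p) (lz p) (S p)) \<in> borel_measurable N"
  unfolding azimuth_int_def by (rule borel_measurable_LBINT_param) measurable

lemma borel_measurable_G_abs [measurable (raw)]:
  assumes [measurable]: "e \<in> borel_measurable N" "l \<in> borel_measurable N"
  shows "(\<lambda>p. G_abs (e p) (l p) xi) \<in> borel_measurable N"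
  unfolding G_abs_def by (rule borel_measurable_LBINT_param) measurable

text \<open>Variant of \<open>G_scat\<close> with a free lower limit, so that the measurable cut-off
  \<open>xi0_scat\<close> can take the place of \<open>xi0\<close>.\<close>

definition G_from :: "real \<Rightarrow> real \<Rightarrow> real \<Rightarrow> real \<Rightarrow> real \<Rightarrow> real" where
  "G_from x0 sg e l xi = (LBINT x=ereal x0..ereal xi. ffun sg e l x)"

lemma borel_measurable_G_from [measurable (raw)]:
  assumes [measurable]: "x0 \<in> borel_measurable N" "e \<in> borel_measurable N" "l \<in> borel_measurable N"
  shows "(\<lambda>p. G_from (x0 p) sg (e p) (l p) xi) \<in> borel_measurable N"
  unfolding G_from_def by (rule borel_measurable_LBINT_param) measurable

lemma borel_measurable_radQ3 [measurable (raw)]: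
  assumes [measurable]: "x0 \<in> borel_measurable N" "e \<in> borel_measurable N" "l \<in> borel_measurable N"
  shows "(\<lambda>p. radQ3 sg (e p) (l p) (x0 p) xi) \<in> borel_measurable N"
proof -
  have [measurable]: "(\<lambda>p. LBINT x=ereal (x0 p)..ereal xi. 1 / (x\<^sup>2 * sg * sfun (e p) (l p) x)) \<in> borel_measurable N"
    by (rule borel_measurable_LBINT_param) measurable
  show ?thesis unfolding radQ3_def by measurable
qed

section \<open>Momentum functions on the cotangent fibre\<close>

lemma inner_ginv:
  "p \<bullet> (ginv M r th *v p) = - (1 + 2 * M / r) * (p $ 0)\<^sup>2 + 4 * M / r * (p $ 0) * (p $ 1)
     + (1 - 2 * M / r) * (p $ 1)\<^sup>2 + (p $ 2)\<^sup>2 / r\<^sup>2 + (p $ 3)\<^sup>2 / (r\<^sup>2 * (sin th)\<^sup>2)"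
  "(ginv M r th *v p) $ 0 = - (1 + 2 * M / r) * p $ 0 + 2 * M / r * p $ 1"
proof -
  \<comment> \<open>In the index type \<open>4\<close> the numeral 4 wraps round to 0, so the last
    summand of \<open>sum_4\<close> is the time component.\<close>
  have 4: "(4::4) = 0" by simp
  have eq: "(ginv M r th *v p) $ 0 = - (1 + 2 * M / r) * p $ 0 + 2 * M / r * p $ 1"
    "(ginv M r th *v p) $ 1 = (1 - 2 * M / r) * p $ 1 + 2 * M / r * p $ 0"
    "(ginv M r th *v p) $ 2 = p $ 2 / r\<^sup>2"
    "(ginv M r th *v p) $ 3 = p $ 3 / (r\<^sup>2 * (sin th)\<^sup>2)"
    unfolding matrix_vector_mult_def sum_4 4 by (simp_all add: ginv_def)
  show "p \<bullet> (ginv M r th *v p) = - (1 + 2 * M / r) * (p $ 0)\<^sup>2 + 4 * M / r * (p $ 0) * (p $ 1)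
     + (1 - 2 * M / r) * (p $ 1)\<^sup>2 + (p $ 2)\<^sup>2 / r\<^sup>2 + (p $ 3)\<^sup>2 / (r\<^sup>2 * (sin th)\<^sup>2)"
    unfolding inner_vec_def sum_4 4 eq by (simp add: algebra_simps power2_eq_square)
  show "(ginv M r th *v p) $ 0 = - (1 + 2 * M / r) * p $ 0 + 2 * M / r * p $ 1" by (rule eq)
qed

lemma borel_measurable_shell_vars [measurable]:
  "(\<lambda>p::real^4. p $ i) \<in> borel_measurable borel"
  "eps_of m \<in> borel_measurable borel" "lamz_of M m \<in> borel_measurable borel"
  "lam_of M m th \<in> borel_measurable borel" "pixi_of m \<in> borel_measurable borel"
  "pith_of M m \<in> borel_measurable borel" "Measurable.pred borel (fut_timelike M r th)"
proof -
  show [measurable]: "(\<lambda>p::real^4. p $ i) \<in> borel_measurable borel" for i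
    by (intro borel_measurable_continuous_onI continuous_intros)
  show "eps_of m \<in> borel_measurable borel" "lamz_of M m \<in> borel_measurable borel"
    "lam_of M m th \<in> borel_measurable borel" "pixi_of m \<in> borel_measurable borel"
    "pith_of M m \<in> borel_measurable borel" "Measurable.pred borel (fut_timelike M r th)"
    unfolding eps_of_def[abs_def] lamz_of_def[abs_def] lam_of_def[abs_def] pixi_of_def[abs_def]
      pith_of_def[abs_def] fut_timelike_def[abs_def] inner_ginv by measurable
qed

subsection \<open>The solution on the fibre\<close>

text \<open>The arguments of the initial data with the time shift included. The angular integrals
  appear in closed or Lebesgue form; the sign, the reference radius and the function
  \<open>G\<close> are left free to serve both kinds of orbit.\<close>

definition orbit_vars :: "real \<Rightarrow> real \<Rightarrow> real \<Rightarrow> real \<Rightarrow> real \<Rightarrow> real \<Rightarrow> real \<Rightarrow> real \<Rightarrow> (real^4 \<Rightarrow> real) \<Rightarrow> real^4 \<Rightarrow>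
     real \<times> real \<times> real \<times> real \<times> real \<times> real" where
  "orbit_vars M m t r th ph sg x0 G p =
     (let e = eps_of m p; lz = lamz_of M m p; l = lam_of M m th p; S = ang_par l lz th (pith_of M m p)
      in (G p - t / M, ph - lz * azimuth_int l lz S, radQ3 sg e l x0 (r / M) + S, e, lz, l))"

abbreviation orbit_abs where
  "orbit_abs M m t r th ph p \<equiv> orbit_vars M m t r th ph (-1) 2 (\<lambda>p. G_abs (eps_of m p) (lam_of M m th p) (r / M)) p"

abbreviation orbit_scat where
  "orbit_scat M m t r th ph sg p \<equiv>
     orbit_vars M m t r th ph sg (xi0_scat (eps_of m p) (lam_of M m th p))
       (\<lambda>p. G_from (xi0_scat (eps_of m p) (lam_of M m th p)) sg (eps_of m p) (lam_of M m th p) (r / M)) p"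

text \<open>This is the curve equation required by the evaluation of the angular integrals.\<close>

lemma lam_of_squared:
  "(lam_of M m th p)\<^sup>2 = (pith_of M m p)\<^sup>2 + (lamz_of M m p)\<^sup>2 / (sin th)\<^sup>2"
  by (simp add: lam_of_def pith_of_def lamz_of_def power_divide add_divide_distrib)

text \<open>In the accretion region the terms built from \<open>THE\<close>, \<open>GREATEST\<close>
  and gauge integrals can be exchanged for expressions already known to be measurable.\<close>

lemma fsol_in_Gacc:
  assumes "0 < th" "th < pi" "in_Gacc M m r th p"
  shows "fsol Fa Fs M m t r th ph p =
    (if lam_of M m th p < lam_c (eps_of m p) then Fa (orbit_abs M m t r th ph p)
     else if pixi_of m p = pixi 1 (eps_of m p) (lam_of M m th p) (r / M) then Fs (orbit_scat M m t r th ph 1 p)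
     else Fs (orbit_scat M m t r th ph (-1) p))"
proof -
  have "\<bar>lamz_of M m p\<bar> < lam_of M m th p" using assms(3) by (simp add: in_Gacc_def Let_def)
  note ang = this lam_of_squared[of M m th p]
  have "\<not> lam_of M m th p < lam_c (eps_of m p) \<Longrightarrow>
      xi0_scat (eps_of m p) (lam_of M m th p) = xi0 (eps_of m p) (lam_of M m th p)"
    using assms(3) by (auto simp: in_Gacc_def Let_def xi0_scat_def)
  then show ?thesis using assms
    by (simp add: fsol_def acc_vars_def orbit_vars_def Let_def G_scat_def G_from_def
        line_int_inverse_momentum[OF assms(1,2) ang] line_int_azimuth[OF assms(1,2) ang])
qed

text \<open>\<open>G_abs\<close> is nonpositive outside the horizon and nonnegative times only lower
  the first argument, so the data are evaluated where their bounds hold.\<close>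

lemma orbit_abs_in_R_abs:
  assumes "M > 0" "r > 2 * M" "t \<ge> 0" "in_Gacc M m r th p" "lam_of M m th p < lam_c (eps_of m p)"
  shows "orbit_abs M m t r th ph p \<in> R_abs"
proof -
  have *: "eps_of m p > 1" "\<bar>lamz_of M m p\<bar> < lam_of M m th p"
    using assms by (auto simp: in_Gacc_def Let_def)
  have "G_abs (eps_of m p) (lam_of M m th p) (r / M) \<le> 0"
    using assms * by (intro G_abs_nonpos) (auto simp: field_simps)
  moreover have "t / M \<ge> 0" using assms by simp
  ultimately have "G_abs (eps_of m p) (lam_of M m th p) (r / M) \<le> t / M" by linarith
  with * show ?thesis using assms by (auto simp: orbit_vars_def R_abs_def Let_def)
qed

lemma orbit_scat_in_R_scat:
  assumes "in_Gacc M m r th p" "\<not> lam_of M m th p < lam_c (eps_of m p)"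
  shows "orbit_vars M m t r th ph sg x0 G p \<in> R_scat"
  using assms by (auto simp: orbit_vars_def R_scat_def Let_def in_Gacc_def)

lemma pred_in_Gacc [measurable]: "Measurable.pred borel (in_Gacc M m r th)"
proof -
  have *: "in_Gacc M m r th = (\<lambda>p. fut_timelike M r th p \<and> eps_of m p > 1 \<and> \<bar>lamz_of M m p\<bar> < lam_of M m th p \<and>
      ((lam_of M m th p < lam_c (eps_of m p) \<and> pixi_of m p = pixi (-1) (eps_of m p) (lam_of M m th p) (r / M)) \<or>
       (lam_of M m th p > lam_c (eps_of m p) \<and> r / M \<ge> xi0_scat (eps_of m p) (lam_of M m th p) \<and>
         (pixi_of m p = pixi 1 (eps_of m p) (lam_of M m th p) (r / M) \<or>
          pixi_of m p = pixi (-1) (eps_of m p) (lam_of M m th p) (r / M)))))"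
    by (rule ext) (auto simp: in_Gacc_def Let_def xi0_scat_def)
  show ?thesis unfolding * by measurable
qed

lemma borel_measurable_orbit_vars [measurable]:
  "(\<lambda>p. orbit_abs M m t r th ph p) \<in> borel_measurable borel"
  "(\<lambda>p. orbit_scat M m t r th ph sg p) \<in> borel_measurable borel"
  unfolding orbit_vars_def Let_def borel_prod[symmetric] by measurable

text \<open>The data are measurable only on their regions. The orbit variables lie in those regions
  whenever the data are evaluated, so multiplying by the indicators changes nothing and yields
  globally measurable factors.\<close>

lemma borel_measurable_fsol:
  assumes "M > 0" "r > 2 * M" "t \<ge> 0" "0 < th" "th < pi"
    and "set_borel_measurable borel R_abs Fa" "set_borel_measurable borel R_scat Fs"
  shows "fsol Fa Fs M m t r th ph \<in> borel_measurable borel"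
proof -
  have [measurable]: "(\<lambda>x. indicat_real R_abs x *\<^sub>R Fa x) \<in> borel_measurable borel"
    "(\<lambda>x. indicat_real R_scat x *\<^sub>R Fs x) \<in> borel_measurable borel"
    using assms by (auto simp: set_borel_measurable_def)
  have "fsol Fa Fs M m t r th ph = (\<lambda>p. if in_Gacc M m r th p then
    (if lam_of M m th p < lam_c (eps_of m p)
       then (\<lambda>x. indicat_real R_abs x *\<^sub>R Fa x) (orbit_abs M m t r th ph p)
     else if pixi_of m p = pixi 1 (eps_of m p) (lam_of M m th p) (r / M)
       then (\<lambda>x. indicat_real R_scat x *\<^sub>R Fs x) (orbit_scat M m t r th ph 1 p)
     else (\<lambda>x. indicat_real R_scat x *\<^sub>R Fs x) (orbit_scat M m t r th ph (-1) p)) else 0)"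
  proof
    fix p show "fsol Fa Fs M m t r th ph p = (if in_Gacc M m r th p then
    (if lam_of M m th p < lam_c (eps_of m p)
       then (\<lambda>x. indicat_real R_abs x *\<^sub>R Fa x) (orbit_abs M m t r th ph p)
     else if pixi_of m p = pixi 1 (eps_of m p) (lam_of M m th p) (r / M)
       then (\<lambda>x. indicat_real R_scat x *\<^sub>R Fs x) (orbit_scat M m t r th ph 1 p)
     else (\<lambda>x. indicat_real R_scat x *\<^sub>R Fs x) (orbit_scat M m t r th ph (-1) p)) else 0)"
      using orbit_abs_in_R_abs[OF assms(1-3), of m th p ph] orbit_scat_in_R_scat[of M m r th p t] assms
      by (cases "in_Gacc M m r th p") (simp_all add: fsol_in_Gacc, simp add: fsol_def)
  qed
  also have "\<dots> \<in> borel_measurable borel"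
    by measurable
  finally show ?thesis .
qed

lemma fsol_bounds:
  assumes "M > 0" "r > 2 * M" "t \<ge> 0" "0 < th" "th < pi" "C > 0"
    and bd_abs: "\<forall>G q2 q3 e lz l. (G, q2, q3, e, lz, l) \<in> R_abs \<longrightarrow>
          0 \<le> Fa (G, q2, q3, e, lz, l) \<and> Fa (G, q2, q3, e, lz, l) \<le> C * exp (- b * e)"
    and bd_scat: "\<forall>G q2 q3 e lz l. (G, q2, q3, e, lz, l) \<in> R_scat \<longrightarrow>
          0 \<le> Fs (G, q2, q3, e, lz, l) \<and> Fs (G, q2, q3, e, lz, l) \<le> C * exp (- b * e)"
  shows "\<bar>fsol Fa Fs M m t r th ph p\<bar> \<le> C * exp (- b * eps_of m p)"
proof (cases "in_Gacc M m r th p")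
  case True
  have bd: "\<bar>Fa x\<bar> \<le> C * exp (- b * fst (snd (snd (snd x))))" if "x \<in> R_abs" for x
    using that bd_abs by (cases x) auto
  have bd': "\<bar>Fs x\<bar> \<le> C * exp (- b * fst (snd (snd (snd x))))" if "x \<in> R_scat" for x
    using that bd_scat by (cases x) auto
  have "\<bar>Fa (orbit_abs M m t r th ph p)\<bar> \<le> C * exp (- b * eps_of m p)" if "lam_of M m th p < lam_c (eps_of m p)"
    using bd[OF orbit_abs_in_R_abs[OF assms(1-3) True that, of ph]] by (simp add: orbit_vars_def Let_def)
  moreover have "\<bar>Fs (orbit_scat M m t r th ph sg p)\<bar> \<le> C * exp (- b * eps_of m p)"
    if "\<not> lam_of M m th p < lam_c (eps_of m p)" for sg
    using bd'[OF orbit_scat_in_R_scat[OF True that]] by (simp add: orbit_vars_def Let_def)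
  ultimately show ?thesis using True assms(4,5) by (auto simp: fsol_in_Gacc)
next
  case False
  then show ?thesis using assms by (simp add: fsol_def)
qed

section \<open>Periodicity in the angles and the pointwise limit\<close>

lemma periodic_int_shift:
  fixes f :: "real \<Rightarrow> 'a"
  assumes "\<And>x. f (x + T) = f x"
  shows "f (x + of_int n * T) = f x"
proof (induction n rule: int_induct[where k = 0])
  case (step1 i)
  have "f (x + of_int (i + 1) * T) = f ((x + of_int i * T) + T)" by (simp add: algebra_simps)
  then show ?case using assms step1 by simp
next
  case (step2 i)
  have "f (x + of_int i * T) = f ((x + of_int (i - 1) * T) + T)" by (simp add: algebra_simps)
  then show ?case using assms step2 by simp
qed simp

lemma mod_2pi_rep:
  obtains n :: int and y :: real where "y \<in> {0..2*pi}" "x = y + of_int n * (2 * pi)"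
proof
  define n where "n = \<lfloor>x / (2 * pi)\<rfloor>"
  have "of_int n \<le> x / (2 * pi)" "x / (2 * pi) \<le> of_int n + 1" unfolding n_def by linarith+
  then have "of_int n * (2 * pi) \<le> x" "x \<le> (of_int n + 1) * (2 * pi)"
    by (simp_all only: le_divide_eq divide_le_eq pi_gt_zero zero_less_mult_iff zero_less_numeral simp_thms if_True)
  then show "x - of_int n * (2 * pi) \<in> {0..2*pi}" by (auto simp: algebra_simps)
qed simp

lemma periodic_pair_reduce:
  fixes F :: "real \<Rightarrow> real \<Rightarrow> 'a"
  assumes "\<And>x y. F (x + 2 * pi) y = F x y" "\<And>x y. F x (y + 2 * pi) = F x y"
  shows "F (u + of_int i * (2 * pi)) (v + of_int j * (2 * pi)) = F u v"
  using periodic_int_shift[of "\<lambda>x. F x (v + of_int j * (2 * pi))" "2 * pi" u i]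
    periodic_int_shift[of "F u" "2 * pi" v j] assms by simp

text \<open>The limits of the data are given for angles in one period, so the two angular variables
  are first reduced by integers independent of time. The first argument then runs to minus infinity
  with all others fixed.\<close>

lemma fsol_tendsto:
  assumes "M > 0" "r > 2 * M" "0 < th" "th < pi"
    and per_abs: "\<forall>G q2 q3 e lz l. (G, q2, q3, e, lz, l) \<in> R_abs \<longrightarrow>
          Fa (G, q2 + 2*pi, q3, e, lz, l) = Fa (G, q2, q3, e, lz, l) \<and>
          Fa (G, q2, q3 + 2*pi, e, lz, l) = Fa (G, q2, q3, e, lz, l)"
    and per_scat: "\<forall>G q2 q3 e lz l. (G, q2, q3, e, lz, l) \<in> R_scat \<longrightarrow>
          Fs (G, q2 + 2*pi, q3, e, lz, l) = Fs (G, q2, q3, e, lz, l) \<and>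
          Fs (G, q2, q3 + 2*pi, e, lz, l) = Fs (G, q2, q3, e, lz, l)"
    and lim_abs: "\<forall>q2 \<in> {0..2*pi}. \<forall>q3 \<in> {0..2*pi}. \<forall>e lz l.
          e > 1 \<and> \<bar>lz\<bar> < l \<and> l < lam_c e \<longrightarrow>
          ((\<lambda>G. Fa (G, q2, q3, e, lz, l)) \<longlongrightarrow> fm e) at_bot"
    and lim_scat: "\<forall>q2 \<in> {0..2*pi}. \<forall>q3 \<in> {0..2*pi}. \<forall>e lz l.
          e > 1 \<and> \<bar>lz\<bar> < l \<and> l > lam_c e \<longrightarrow>
          ((\<lambda>G. Fs (G, q2, q3, e, lz, l)) \<longlongrightarrow> fm e) at_bot"
  shows "((\<lambda>t. fsol Fa Fs M m t r th ph p) \<longlongrightarrow> fstat fm M m r th p) at_top"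
proof (cases "in_Gacc M m r th p")
  case True
  define e where "e = eps_of m p"
  define lz where "lz = lamz_of M m p"
  define l where "l = lam_of M m th p"
  have e: "e > 1" "\<bar>lz\<bar> < l" using True by (auto simp: in_Gacc_def Let_def e_def lz_def l_def)
  have shift: "filterlim (\<lambda>t. G - t / M) at_bot at_top" for G
    unfolding filterlim_at_bot_dense
  proof
    fix y
    have "\<forall>\<^sub>F t in at_top. t > (G - y) * M" by (rule eventually_gt_at_top)
    then show "\<forall>\<^sub>F t in at_top. G - t / M < y"
      by eventually_elim (use assms(1) in \<open>simp add: field_simps\<close>)
  qed
  show ?thesis
  proof (cases "l < lam_c e")
    case l: True
    obtain G q2 q3 where orbit: "\<And>t. orbit_abs M m t r th ph p = (G - t / M, q2, q3, e, lz, l)"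
      by (simp add: orbit_vars_def Let_def e_def[symmetric] lz_def[symmetric] l_def[symmetric])
    obtain i y where y: "y \<in> {0..2*pi}" "q2 = y + of_int i * (2 * pi)" by (rule mod_2pi_rep)
    obtain j z where z: "z \<in> {0..2*pi}" "q3 = z + of_int j * (2 * pi)" by (rule mod_2pi_rep)
    have "((\<lambda>t. Fa (G - t / M, y, z, e, lz, l)) \<longlongrightarrow> fm e) at_top"
      using filterlim_compose[OF _ shift] lim_abs e l y(1) z(1) by blast
    \<comment> \<open>Periodicity of the absorbed data is available only for nonpositive first
      argument, hence the wait until \<open>G - t / M < 0\<close>.\<close>
    moreover have "\<forall>\<^sub>F t in at_top. Fa (G - t / M, y, z, e, lz, l) = fsol Fa Fs M m t r th ph p"
      using shift[unfolded filterlim_at_bot_dense, rule_format, of G 0]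
    proof eventually_elim
      case (elim t)
      have "Fa (G - t / M, u + 2 * pi, v, e, lz, l) = Fa (G - t / M, u, v, e, lz, l)"
        "Fa (G - t / M, u, v + 2 * pi, e, lz, l) = Fa (G - t / M, u, v, e, lz, l)" for u v
        using per_abs e l elim by (auto simp: R_abs_def)
      then have "Fa (G - t / M, q2, q3, e, lz, l) = Fa (G - t / M, y, z, e, lz, l)"
        unfolding y(2) z(2) by (rule periodic_pair_reduce)
      then show ?case using l True assms by (simp add: fsol_in_Gacc orbit e_def l_def)
    qed
    ultimately show ?thesis using True by (simp add: fstat_def e_def[symmetric] tendsto_cong)
  next
    case nl: False
    then have l: "l > lam_c e" using True by (auto simp: in_Gacc_def Let_def e_def l_def)
    define sg :: real where "sg = (if pixi_of m p = pixi 1 e l (r / M) then 1 else -1)"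
    obtain G q2 q3 where orbit: "\<And>t. orbit_scat M m t r th ph sg p = (G - t / M, q2, q3, e, lz, l)"
      by (simp add: orbit_vars_def Let_def e_def[symmetric] lz_def[symmetric] l_def[symmetric])
    have fsol: "fsol Fa Fs M m t r th ph p = Fs (G - t / M, q2, q3, e, lz, l)" for t
      unfolding orbit[of t, symmetric]
      using True assms nl by (auto simp: fsol_in_Gacc sg_def e_def l_def)
    obtain i y where y: "y \<in> {0..2*pi}" "q2 = y + of_int i * (2 * pi)" by (rule mod_2pi_rep)
    obtain j z where z: "z \<in> {0..2*pi}" "q3 = z + of_int j * (2 * pi)" by (rule mod_2pi_rep)
    have "((\<lambda>t. Fs (G - t / M, y, z, e, lz, l)) \<longlongrightarrow> fm e) at_top"
      using filterlim_compose[OF _ shift] lim_scat e l y(1) z(1) by blast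
    moreover have "Fs (G - t / M, y, z, e, lz, l) = fsol Fa Fs M m t r th ph p" for t
    proof -
      have "Fs (G - t / M, u + 2 * pi, v, e, lz, l) = Fs (G - t / M, u, v, e, lz, l)"
        "Fs (G - t / M, u, v + 2 * pi, e, lz, l) = Fs (G - t / M, u, v, e, lz, l)" for u v
        using per_scat e l by (auto simp: R_scat_def)
      then have "Fs (G - t / M, q2, q3, e, lz, l) = Fs (G - t / M, y, z, e, lz, l)"
        unfolding y(2) z(2) by (rule periodic_pair_reduce)
      then show ?thesis by (simp add: fsol)
    qed
    ultimately show ?thesis using True by (simp add: fstat_def e_def[symmetric])
  qed
qed (simp add: fsol_def fstat_def)

subsection \<open>Resolution of the mass shell\<close>

lemma mom_nth [simp]:
  "mom a0 a1 a2 a3 $ 0 = a0" "mom a0 a1 a2 a3 $ 1 = a1" "mom a0 a1 a2 a3 $ 2 = a2" "mom a0 a1 a2 a3 $ 3 = a3"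
  by (simp_all add: mom_def)

text \<open>A quarter of the discriminant of the mass-shell equation, read as a quadratic in the
  time component of the momentum.\<close>

definition shell_disc :: "real \<Rightarrow> real \<Rightarrow> real \<Rightarrow> real \<Rightarrow> real \<Rightarrow> real \<Rightarrow> real \<Rightarrow> real" where
  "shell_disc M m r th a1 a2 a3 =
     a1\<^sup>2 + (1 + 2 * M / r) * (m\<^sup>2 + a2\<^sup>2 / r\<^sup>2 + a3\<^sup>2 / (r\<^sup>2 * (sin th)\<^sup>2))"

text \<open>The smaller root of the mass-shell quadratic is taken; it is the future-directed
  one.\<close>

definition shell_mom :: "real \<Rightarrow> real \<Rightarrow> real \<Rightarrow> real \<Rightarrow> real \<Rightarrow> real \<Rightarrow> real \<Rightarrow> real^4" where
  "shell_mom M m r th a1 a2 a3 =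
     mom ((2 * M / r * a1 - sqrt (shell_disc M m r th a1 a2 a3)) / (1 + 2 * M / r)) a1 a2 a3"

lemma shell_disc_pos:
  assumes "M > 0" "r > 0" "m > 0"
  shows "shell_disc M m r th a1 a2 a3 > 0"
  using assms unfolding shell_disc_def
  by (intro add_nonneg_pos mult_pos_pos add_pos_nonneg) auto

text \<open>The mass shell has two roots over each spatial momentum. The larger contributes nothing,
  being past-directed; at the smaller the derivative of \<open>P0\<close> has modulus
  \<open>sqrt D / m\<close>, which supplies the density.\<close>

lemma delta_int_future:
  assumes "M > 0" "r > 0" "m > 0" and future: "\<And>p. \<not> fut_timelike M r th p \<Longrightarrow> h p = 0"
  shows "delta_int M m r th h = (LINT (a1, a2, a3)|lborel. h (shell_mom M m r th a1 a2 a3) *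
     (sqrt (- det (ginv M r th)) * (m / sqrt (shell_disc M m r th a1 a2 a3))))"
  unfolding delta_int_def
proof (rule Bochner_Integration.integral_cong[OF refl], clarify)
  fix a1 a2 a3 :: real
  define B where "B = 2 * M / r"
  define A where "A = 1 + B"
  define D where "D = shell_disc M m r th a1 a2 a3"
  define q where "q b = - (mom b a1 a2 a3 \<bullet> (ginv M r th *v mom b a1 a2 a3))" for b
  have A: "A > 0" "A = 1 + B" using assms by (auto simp: A_def B_def add_pos_pos)
  have D: "D > 0" unfolding D_def by (intro shell_disc_pos assms)
  have q_eq: "q b = A * b\<^sup>2 - 2 * B * b * a1 - (1 - B) * a1\<^sup>2 - a2\<^sup>2 / r\<^sup>2 - a3\<^sup>2 / (r\<^sup>2 * (sin th)\<^sup>2)" for b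
    by (simp add: q_def inner_ginv A_def B_def algebra_simps)
  \<comment> \<open>Completing the square turns the shell condition into
    \<open>(A * b - B * a1)\<^sup>2 = D\<close>.\<close>
  have square: "A * q b = (A * b - B * a1)\<^sup>2 - D + A * m\<^sup>2" for b
    unfolding q_eq D_def shell_disc_def B_def[symmetric] A(2)
    by (simp add: algebra_simps power2_eq_square)
  have P0_q: "P0 M r th (mom b a1 a2 a3) = sqrt (q b)" for b by (simp add: P0_def q_def)
  define lo where "lo = (B * a1 - sqrt D) / A"
  define hi where "hi = (B * a1 + sqrt D) / A"
  have lohi: "lo \<noteq> hi" using D A(1) by (simp add: lo_def hi_def)
  have "sqrt (q b) = m \<longleftrightarrow> b = lo \<or> b = hi" for b
  proof -
    have "sqrt (q b) = m \<longleftrightarrow> q b = m\<^sup>2" using assms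
      by (metis real_sqrt_eq_iff real_sqrt_abs abs_of_pos)
    also have "\<dots> \<longleftrightarrow> A * q b = A * m\<^sup>2" using A(1) by simp
    also have "\<dots> \<longleftrightarrow> (A * b - B * a1)\<^sup>2 = (sqrt D)\<^sup>2" unfolding square using D by auto
    also have "\<dots> \<longleftrightarrow> b = lo \<or> b = hi" unfolding power2_eq_iff lo_def hi_def
      using A(1) by (auto simp: field_simps)
    finally show ?thesis .
  qed
  then have roots: "{a0. P0 M r th (mom a0 a1 a2 a3) = m} = {lo, hi}" and qlo: "sqrt (q lo) = m"
    by (auto simp: P0_q)
  \<comment> \<open>At \<open>hi\<close> the raised time component is
    \<open>- sqrt D\<close>.\<close>
  have "\<not> fut_timelike M r th (mom hi a1 a2 a3)"
    using D A(1) by (simp add: fut_timelike_def inner_ginv B_def[symmetric] A_def[symmetric] hi_def)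
  then have hi0: "h (mom hi a1 a2 a3) = 0" by (rule future)
  have "q lo > 0" using qlo assms(3) real_sqrt_gt_0_iff[of "q lo"] by simp
  moreover have "(q has_real_derivative 2 * (A * b - B * a1)) (at b)" for b
    unfolding q_eq[abs_def] by (auto intro!: derivative_eq_intros simp: algebra_simps)
  ultimately have "((\<lambda>b. sqrt (q b)) has_real_derivative inverse (sqrt (q lo)) / 2 * (2 * (A * lo - B * a1))) (at lo)"
    by (intro DERIV_chain2[where f = sqrt and g = q, OF DERIV_real_sqrt])
  then have "deriv (\<lambda>b. sqrt (q b)) lo = inverse (sqrt (q lo)) / 2 * (2 * (A * lo - B * a1))"
    by (rule DERIV_imp_deriv)
  also have "A * lo - B * a1 = - sqrt D" using A(1) by (simp add: lo_def)
  finally have "deriv (\<lambda>b. P0 M r th (mom b a1 a2 a3)) lo = - (sqrt D / m)"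
    unfolding P0_q qlo inverse_eq_divide by simp
  moreover have "shell_mom M m r th a1 a2 a3 = mom lo a1 a2 a3"
    by (simp add: shell_mom_def lo_def D_def A_def B_def)
  ultimately show "(\<Sum>a0\<in>{a0. P0 M r th (mom a0 a1 a2 a3) = m}. h (mom a0 a1 a2 a3) * sqrt (- det (ginv M r th))
           / \<bar>deriv (\<lambda>b. P0 M r th (mom b a1 a2 a3)) a0\<bar>) =
       h (shell_mom M m r th a1 a2 a3) *
         (sqrt (- det (ginv M r th)) * (m / sqrt (shell_disc M m r th a1 a2 a3)))"
    unfolding roots using lohi hi0 D assms by (simp add: D_def[symmetric])
qed

text \<open>All momentum components are bounded by multiples of \<open>s\<close>, while the energy
  is at least a positive multiple of \<open>s\<close> because \<open>2 * M / r < 1\<close> outside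
  the horizon. Exponential decay in the energy thus becomes decay in every spatial momentum
  component.\<close>

lemma shell_estimates:
  fixes r a1 a2 a3 :: real
  assumes "M > 0" "r > 2 * M" "m > 0" "0 < th" "th < pi"
  defines "s \<equiv> sqrt (shell_disc M m r th a1 a2 a3)" and "p \<equiv> shell_mom M m r th a1 a2 a3"
  shows "m \<le> s" "\<bar>a1\<bar> + \<bar>a2\<bar> + \<bar>a3\<bar> \<le> (1 + 2 * r) * s" "norm p \<le> (2 + 2 * r) * s"
    "eps_of m p \<ge> (1 - 2 * M / r) / ((1 + 2 * M / r) * m) * s"
proof -
  define B where "B = 2 * M / r"
  have B: "0 < B" "B < 1" and r: "r > 0" using assms by (auto simp: B_def)
  define D where "D = shell_disc M m r th a1 a2 a3"
  have st: "sin th > 0" using assms sin_gt_zero by blast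
  define W where "W = m\<^sup>2 + a2\<^sup>2 / r\<^sup>2 + a3\<^sup>2 / (r\<^sup>2 * (sin th)\<^sup>2)"
  have nn: "0 \<le> a2\<^sup>2 / r\<^sup>2" "0 \<le> a3\<^sup>2 / (r\<^sup>2 * (sin th)\<^sup>2)" by auto
  then have "W \<ge> 0" by (simp add: W_def)
  have "D = a1\<^sup>2 + (1 + B) * W" by (simp add: D_def shell_disc_def B_def W_def)
  moreover have "1 * W \<le> (1 + B) * W" using B \<open>W \<ge> 0\<close> by (intro mult_right_mono) auto
  ultimately have D: "a1\<^sup>2 + W \<le> D" by simp
  \<comment> \<open>Dropping the sine from the denominator only shrinks the azimuthal term, so one
    radius-dependent constant suffices for both angular components.\<close>
  have "(sin th)\<^sup>2 \<le> 1" by (simp add: abs_square_le_1)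
  then have "r\<^sup>2 * (sin th)\<^sup>2 \<le> r\<^sup>2" by (simp add: mult_left_le)
  then have "a3\<^sup>2 / r\<^sup>2 \<le> a3\<^sup>2 / (r\<^sup>2 * (sin th)\<^sup>2)" using r st by (intro divide_left_mono) auto
  then have sq: "m\<^sup>2 \<le> D" "a1\<^sup>2 \<le> D" "(a2 / r)\<^sup>2 \<le> D" "(a3 / r)\<^sup>2 \<le> D"
    using D nn zero_le_power2[of a1] zero_le_power2[of m] unfolding W_def power_divide by linarith+
  have le: "\<bar>x\<bar> \<le> s" if "x\<^sup>2 \<le> D" for x
    using real_sqrt_le_mono[OF that] by (simp add: s_def D_def)
  show ms: "m \<le> s" using le[OF sq(1)] by simp
  have s: "s > 0" using ms assms by linarith
  have a1: "\<bar>a1\<bar> \<le> s" by (rule le[OF sq(2)])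
  have a23: "\<bar>a2\<bar> \<le> r * s" "\<bar>a3\<bar> \<le> r * s"
    using le[OF sq(3)] le[OF sq(4)] r by (auto simp: field_simps)
  show "\<bar>a1\<bar> + \<bar>a2\<bar> + \<bar>a3\<bar> \<le> (1 + 2 * r) * s"
    using a1 a23 by (simp add: algebra_simps)
  define a0 where "a0 = (B * a1 - s) / (1 + B)"
  have p: "p = mom a0 a1 a2 a3" by (simp add: p_def shell_mom_def a0_def B_def s_def)
  have Ba: "\<bar>B * a1\<bar> \<le> B * s" using a1 B by (simp add: abs_mult)
  then have "\<bar>B * a1 - s\<bar> \<le> (1 + B) * s" using s by (simp add: algebra_simps)
  then have a0: "\<bar>a0\<bar> \<le> s" using B by (simp add: a0_def field_simps)
  have "norm p \<le> (\<Sum>i\<in>UNIV. \<bar>p $ i\<bar>)" by (rule norm_le_l1_cart)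
  also have "\<dots> = \<bar>a1\<bar> + \<bar>a2\<bar> + \<bar>a3\<bar> + \<bar>a0\<bar>"
  proof -
    have 4: "(4::4) = 0" by simp
    show ?thesis unfolding sum_4 4 p by simp
  qed
  also have "\<dots> \<le> (2 + 2 * r) * s" using a0 a1 a23 by (simp add: algebra_simps)
  finally show "norm p \<le> (2 + 2 * r) * s" .
  have "(1 - B) * s \<le> s - B * a1" using Ba by (simp add: algebra_simps)
  then have "(1 - B) * s / ((1 + B) * m) \<le> (s - B * a1) / ((1 + B) * m)"
    using B assms by (intro divide_right_mono) auto
  also have "\<dots> = eps_of m p"
    unfolding eps_of_def p mom_nth a0_def minus_divide_left minus_diff_eq by simp
  finally show "eps_of m p \<ge> (1 - 2 * M / r) / ((1 + 2 * M / r) * m) * s" by (simp add: B_def)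
qed

section \<open>Integrable exponential majorants\<close>

lemma integrable_exp_abs:
  assumes "\<beta> > (0::real)"
  shows "integrable lborel (\<lambda>x::real. exp (- \<beta> * \<bar>x\<bar>))"
proof -
  define g where "g x = indicator {0..} x * exp (- \<beta> * x)" for x :: real
  have "(\<integral>\<^sup>+x. ennreal (exp (- \<beta> * x)) * indicator {0..} x \<partial>lborel) = ennreal (0 - (- (exp (- \<beta> * 0) / \<beta>)))"
  proof (rule nn_integral_FTC_atLeast)
    show "((\<lambda>x. - (exp (- \<beta> * x) / \<beta>)) has_real_derivative exp (- \<beta> * x)) (at x)" for x
      using assms by (auto intro!: derivative_eq_intros)
    have "((\<lambda>x. exp (- \<beta> * x)) \<longlongrightarrow> 0) at_top"
      using assms by (intro filterlim_compose[OF exp_at_bot] filterlim_tendsto_neg_mult_at_bot[OF tendsto_const _ filterlim_ident]) auto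
    then have "((\<lambda>x. - (exp (- \<beta> * x) / \<beta>)) \<longlongrightarrow> - (0 / \<beta>)) at_top"
      using assms by (intro tendsto_intros) auto
    then show "((\<lambda>x. - (exp (- \<beta> * x) / \<beta>)) \<longlongrightarrow> 0) at_top" by simp
  qed auto
  then have "integrable lborel g"
    unfolding g_def by (intro integrableI_nonneg) (auto simp: ennreal_mult' ennreal_indicator mult.commute)
  moreover from this have "integrable lborel (\<lambda>x. g (0 + (-1) * x))"
    by (rule lborel_integrable_real_affine) simp
  \<comment> \<open>The half-line exponential plus its reflection dominates the two-sided one; they
    differ only at 0.\<close>
  ultimately have "integrable lborel (\<lambda>x. g x + g (0 + (-1) * x))" by (rule Bochner_Integration.integrable_add)
  then show ?thesis
    by (rule Bochner_Integration.integrable_bound) (auto simp: g_def indicator_def)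
qed

lemma integrable_mult_pair:
  fixes f :: "'a::euclidean_space \<Rightarrow> real" and g :: "'b::euclidean_space \<Rightarrow> real"
  assumes f: "integrable lborel f" and g: "integrable lborel g"
  shows "integrable lborel (\<lambda>(x, y). f x * g y)"
proof -
  have [measurable]: "f \<in> borel_measurable borel" "g \<in> borel_measurable borel"
    using f g by auto
  show ?thesis unfolding lborel_prod[symmetric]
    by (rule lborel_pair.Fubini_integrable) (use f g in \<open>auto simp: abs_mult\<close>)
qed

subsection \<open>Convergence of the observables\<close>

lemma borel_measurable_shell_mom [measurable]:
  "(\<lambda>(a1, a2, a3). shell_mom M m r th a1 a2 a3) \<in> borel_measurable borel"
proof -
  have "(\<lambda>(a1, a2, a3). (shell_mom M m r th a1 a2 a3) $ i) \<in> borel_measurable borel" for i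
    unfolding shell_mom_def mom_def shell_disc_def borel_prod[symmetric] by simp
  then show ?thesis
    by (subst borel_measurable_euclidean_space) (auto simp: Basis_vec_def inner_axis case_prod_beta')
qed

lemma delta_int_tendsto:
  fixes w :: "real^4 \<Rightarrow> real" and f :: "real \<Rightarrow> real^4 \<Rightarrow> real"
  assumes "M > 0" "r > 2 * M" "m > 0" "0 < th" "th < pi" "b > 0"
    and [measurable]: "w \<in> borel_measurable borel" 
    and w: "\<And>p. \<bar>w p\<bar> \<le> c * (1 + norm p)\<^sup>2"
    and f_meas: "\<And>t. t \<ge> 0 \<Longrightarrow> f t \<in> borel_measurable borel"
    and bound: "\<And>t p. t \<ge> 0 \<Longrightarrow> \<bar>f t p\<bar> \<le> C * exp (- b * eps_of m p)"
    and lim: "\<And>p. ((\<lambda>t. f t p) \<longlongrightarrow> g p) at_top"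
    and future: "\<And>t p. \<not> fut_timelike M r th p \<Longrightarrow> f t p = 0"
      "\<And>p. \<not> fut_timelike M r th p \<Longrightarrow> g p = 0"
  shows "((\<lambda>t. delta_int M m r th (\<lambda>p. w p * f t p)) \<longlongrightarrow> delta_int M m r th (\<lambda>p. w p * g p)) at_top"
proof -
  have r: "r > 0" and B: "2 * M / r < 1" "2 * M / r > 0" using assms by auto
  define K where "K = sqrt (- det (ginv M r th))"
  define s where "s = (\<lambda>(a1, a2, a3). sqrt (shell_disc M m r th a1 a2 a3))"
  define P where "P = (\<lambda>(a1, a2, a3). shell_mom M m r th a1 a2 a3)"
  define H where "H h a = w (P a) * h (P a) * (K * (m / s a))" for h a
  have delta: "delta_int M m r th (\<lambda>p. w p * h p) = integral\<^sup>L lborel (H h)"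
    if "\<And>p. \<not> fut_timelike M r th p \<Longrightarrow> h p = 0" for h
    using that assms(1,3) r
    by (subst delta_int_future) (auto simp: H_def[abs_def] P_def s_def K_def case_prod_beta')
  have [measurable]: "P \<in> borel_measurable borel" unfolding P_def by measurable
  have [measurable]: "s \<in> borel_measurable borel"
    unfolding s_def shell_disc_def borel_prod[symmetric] by measurable
  have H_meas: "H (f t) \<in> borel_measurable lborel" if "t \<ge> 0" for t
    using f_meas[OF that] unfolding H_def by measurable
  have H_lim: "((\<lambda>t. H (f t) a) \<longlongrightarrow> H g a) at_top" for a
    unfolding H_def by (intro tendsto_intros lim)
  \<comment> \<open>The limit inherits measurability as a pointwise limit along the natural-number
    times.\<close>
  have Hg_meas: "H g \<in> borel_measurable lborel"
  proof (rule borel_measurable_LIMSEQ_real)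
    show "(\<lambda>n. H (f (real n)) a) \<longlonglongrightarrow> H g a" for a
      using filterlim_compose[OF H_lim filterlim_real_sequentially] .
  qed (use H_meas in auto)
  define \<kappa> where "\<kappa> = (1 - 2 * M / r) / ((1 + 2 * M / r) * m)"
  have \<kappa>: "\<kappa> > 0" unfolding \<kappa>_def using B assms(3)
    by (intro divide_pos_pos mult_pos_pos) linarith+
  \<comment> \<open>The decay \<open>exp (- (2 * \<beta> * s a))\<close> is split in half: one half
    absorbs the weight, the other remains integrable. \<open>\<delta>\<close> makes the square of
    the bound on \<open>1 + norm (P a)\<close> cost \<open>exp (\<beta> * s a)\<close>;
    \<open>\<eta>\<close> makes the product \<open>E\<close> dominate
    \<open>exp (- (\<beta> * s a))\<close>.\<close>
  define \<beta> where "\<beta> = b * \<kappa> / 2"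
  define \<delta> where "\<delta> = \<beta> / (2 * (2 + 2 * r))"
  define \<eta> where "\<eta> = \<beta> / (1 + 2 * r)"
  have pos: "\<beta> > 0" "\<delta> > 0" "\<eta> > 0" using \<kappa> \<open>b > 0\<close> r by (auto simp: \<beta>_def \<delta>_def \<eta>_def)
  define E where "E = (\<lambda>(x::real, y::real, z::real). exp (- \<eta> * \<bar>x\<bar>) * (exp (- \<eta> * \<bar>y\<bar>) * exp (- \<eta> * \<bar>z\<bar>)))"
  have E_int: "integrable lborel E"
    using integrable_mult_pair[OF integrable_exp_abs integrable_mult_pair[OF integrable_exp_abs integrable_exp_abs], of \<eta> \<eta> \<eta>] pos
    by (simp add: E_def case_prod_beta')
  define c' where "c' = \<bar>c\<bar> * (1 + 1 / \<delta>)\<^sup>2 * \<bar>C\<bar> * \<bar>K\<bar>"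
  have H_bound: "norm (H (f t) a) \<le> c' * E a" if t: "t \<ge> 0" for t a
  proof -
    obtain a1 a2 a3 where a: "a = (a1, a2, a3)" by (cases a)
    note est = shell_estimates[OF assms(1-5), of a1 a2 a3]
    have s: "m \<le> s a" "\<bar>a1\<bar> + \<bar>a2\<bar> + \<bar>a3\<bar> \<le> (1 + 2 * r) * s a" "norm (P a) \<le> (2 + 2 * r) * s a"
      "eps_of m (P a) \<ge> \<kappa> * s a"
      using est by (auto simp: s_def P_def a \<kappa>_def)
    have "1 + norm (P a) \<le> (1 + 1 / \<delta>) * (1 + \<delta> * norm (P a))"
      using pos by (simp add: field_simps)
    also have "\<dots> \<le> (1 + 1 / \<delta>) * exp (\<delta> * norm (P a))"
      using pos by (intro mult_left_mono exp_ge_add_one_self) auto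
    also have "\<dots> \<le> (1 + 1 / \<delta>) * exp (\<delta> * ((2 + 2 * r) * s a))"
      using pos s by (intro mult_left_mono) auto
    also have "\<delta> * ((2 + 2 * r) * s a) = \<beta> * s a / 2" using r by (simp add: \<delta>_def divide_simps)
    finally have "(1 + norm (P a))\<^sup>2 \<le> ((1 + 1 / \<delta>) * exp (\<beta> * s a / 2))\<^sup>2"
      by (intro power_mono) auto
    also have "\<dots> = (1 + 1 / \<delta>)\<^sup>2 * exp (\<beta> * s a)"
      by (simp add: power_mult_distrib power2_eq_square[of "exp _"] exp_add[symmetric])
    finally have "\<bar>c\<bar> * (1 + norm (P a))\<^sup>2 \<le> \<bar>c\<bar> * ((1 + 1 / \<delta>)\<^sup>2 * exp (\<beta> * s a))"
      by (intro mult_left_mono) auto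
    moreover have "c * (1 + norm (P a))\<^sup>2 \<le> \<bar>c\<bar> * (1 + norm (P a))\<^sup>2" by (intro mult_right_mono) auto
    ultimately have w': "\<bar>w (P a)\<bar> \<le> \<bar>c\<bar> * ((1 + 1 / \<delta>)\<^sup>2 * exp (\<beta> * s a))"
      using w[of "P a"] by linarith
    have "C * exp (- b * eps_of m (P a)) \<le> \<bar>C\<bar> * exp (- (2 * \<beta> * s a))"
      using s(4) \<open>b > 0\<close> by (intro mult_mono) (auto simp: \<beta>_def mult.assoc)
    then have f': "\<bar>f t (P a)\<bar> \<le> \<bar>C\<bar> * exp (- (2 * \<beta> * s a))" using bound[OF t, of "P a"] by linarith
    have "\<bar>K * (m / s a)\<bar> \<le> \<bar>K\<bar> * 1"
      unfolding abs_mult using s(1) assms by (intro mult_left_mono) auto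
    then have "norm (H (f t) a) \<le> (\<bar>c\<bar> * ((1 + 1 / \<delta>)\<^sup>2 * exp (\<beta> * s a))) * (\<bar>C\<bar> * exp (- (2 * \<beta> * s a))) * (\<bar>K\<bar> * 1)"
      unfolding H_def real_norm_def abs_mult[of "_ * f _ _"] abs_mult[of "w _"]
      by (intro mult_mono w' f') auto
    also have "\<dots> = c' * (exp (\<beta> * s a) * exp (- (2 * \<beta> * s a)))" by (simp add: c'_def)
    also have "exp (\<beta> * s a) * exp (- (2 * \<beta> * s a)) = exp (- (\<beta> * s a))"
      by (simp add: exp_add[symmetric])
    also have "exp (- (\<beta> * s a)) \<le> E a"
    proof -
      have "\<eta> * (\<bar>a1\<bar> + \<bar>a2\<bar> + \<bar>a3\<bar>) \<le> \<eta> * ((1 + 2 * r) * s a)" using s pos by (intro mult_left_mono) auto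
      also have "\<dots> = \<beta> * s a" using r by (simp add: \<eta>_def)
      finally show ?thesis by (simp add: E_def a exp_add[symmetric] algebra_simps)
    qed
    finally show ?thesis by (simp add: c'_def mult_left_mono)
  qed
  \<comment> \<open>Measurability and the majorant are available only for nonnegative times, so time
    is truncated at 0, which leaves the limit unchanged.\<close>
  have "((\<lambda>t. integral\<^sup>L lborel (H (f (max t 0)))) \<longlongrightarrow> integral\<^sup>L lborel (H g)) at_top"
  proof (rule integral_dominated_convergence_at_top[OF Hg_meas])
    show "integrable lborel (\<lambda>a. c' * E a)" using E_int by simp
    have ev: "\<forall>\<^sub>F t in at_top. H (f t) a = H (f (max t 0)) a" for a
      using eventually_ge_at_top[of 0] by eventually_elim simp
    have "((\<lambda>t. H (f (max t 0)) a) \<longlongrightarrow> H g a) at_top" for a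
      by (rule Lim_transform_eventually[OF H_lim ev])
    then show "AE a in lborel. ((\<lambda>t. H (f (max t 0)) a) \<longlongrightarrow> H g a) at_top" by simp
  qed (use H_meas H_bound in auto)
  moreover have "\<forall>\<^sub>F t in at_top. integral\<^sup>L lborel (H (f (max t 0))) = delta_int M m r th (\<lambda>p. w p * f t p)"
    using eventually_ge_at_top[of 0] by eventually_elim (simp add: delta future)
  moreover have "delta_int M m r th (\<lambda>p. w p * g p) = integral\<^sup>L lborel (H g)"
    by (rule delta) (rule future(2))
  ultimately show ?thesis by (simp add: Lim_transform_eventually)
qed

theorem theorem2:
  fixes M m C b rs ths phs :: real
    and Fa Fs :: "real \<times> real \<times> real \<times> real \<times> real \<times> real \<Rightarrow> real"
    and fm :: "real \<Rightarrow> real"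
  assumes M_pos: "M > 0" and m_pos: "m > 0"
    \<comment> \<open>(i)\<close>
    and meas_abs: "set_borel_measurable borel R_abs Fa"
    and meas_scat: "set_borel_measurable borel R_scat Fs"
    and per_abs: "\<forall>G q2 q3 e lz l. (G, q2, q3, e, lz, l) \<in> R_abs \<longrightarrow>
          Fa (G, q2 + 2*pi, q3, e, lz, l) = Fa (G, q2, q3, e, lz, l) \<and>
          Fa (G, q2, q3 + 2*pi, e, lz, l) = Fa (G, q2, q3, e, lz, l)"
    and per_scat: "\<forall>G q2 q3 e lz l. (G, q2, q3, e, lz, l) \<in> R_scat \<longrightarrow>
          Fs (G, q2 + 2*pi, q3, e, lz, l) = Fs (G, q2, q3, e, lz, l) \<and>
          Fs (G, q2, q3 + 2*pi, e, lz, l) = Fs (G, q2, q3, e, lz, l)"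
    and C_pos: "C > 0" and b_pos: "b > 0"
    and bd_abs: "\<forall>G q2 q3 e lz l. (G, q2, q3, e, lz, l) \<in> R_abs \<longrightarrow>
          0 \<le> Fa (G, q2, q3, e, lz, l) \<and> Fa (G, q2, q3, e, lz, l) \<le> C * exp (- b * e)"
    and bd_scat: "\<forall>G q2 q3 e lz l. (G, q2, q3, e, lz, l) \<in> R_scat \<longrightarrow>
          0 \<le> Fs (G, q2, q3, e, lz, l) \<and> Fs (G, q2, q3, e, lz, l) \<le> C * exp (- b * e)"
    \<comment> \<open>(ii)\<close>
    and lim_abs: "\<forall>q2 \<in> {0..2*pi}. \<forall>q3 \<in> {0..2*pi}. \<forall>e lz l.
          e > 1 \<and> \<bar>lz\<bar> < l \<and> l < lam_c e \<longrightarrow>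
          ((\<lambda>G. Fa (G, q2, q3, e, lz, l)) \<longlongrightarrow> fm e) at_bot"
    \<comment> \<open>(iii)\<close>
    and lim_scat: "\<exists>fp :: real \<Rightarrow> real. \<forall>e > 1.
          (\<forall>d > 0. \<forall>\<^sub>F G in at_top. \<forall>q2 \<in> {0..2*pi}. \<forall>q3 \<in> {0..2*pi}. \<forall>lz l.
              \<bar>lz\<bar> < l \<and> l > lam_c e \<longrightarrow> \<bar>Fs (G, q2, q3, e, lz, l) - fp e\<bar> < d) \<and>
          (\<forall>d > 0. \<forall>\<^sub>F G in at_bot. \<forall>q2 \<in> {0..2*pi}. \<forall>q3 \<in> {0..2*pi}. \<forall>lz l.
              \<bar>lz\<bar> < l \<and> l > lam_c e \<longrightarrow> \<bar>Fs (G, q2, q3, e, lz, l) - fm e\<bar> < d)"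
    \<comment> \<open>static observer\<close>
    and rs_gt: "rs > 2 * M" and ths_gt: "0 < ths" and ths_lt: "ths < pi"
  shows "\<forall>a c :: 4.
     ((\<lambda>t. obsJ (fsol Fa Fs M m t rs ths phs) M m rs ths (frame M rs ths a))
        \<longlongrightarrow> obsJ (fstat fm M m rs ths) M m rs ths (frame M rs ths a)) at_top \<and>
     ((\<lambda>t. obsT (fsol Fa Fs M m t rs ths phs) M m rs ths (frame M rs ths a) (frame M rs ths c))
        \<longlongrightarrow> obsT (fstat fm M m rs ths) M m rs ths (frame M rs ths a) (frame M rs ths c)) at_top"
proof (intro allI conjI)
  obtain fp where fp: "\<And>e d. e > 1 \<Longrightarrow> d > 0 \<Longrightarrow> \<forall>\<^sub>F G in at_bot. \<forall>q2 \<in> {0..2*pi}. \<forall>q3 \<in> {0..2*pi}. \<forall>lz l.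
              \<bar>lz\<bar> < l \<and> l > lam_c e \<longrightarrow> \<bar>Fs (G, q2, q3, e, lz, l) - fm e\<bar> < d"
    using lim_scat by blast
  \<comment> \<open>Uniform convergence at minus infinity yields the pointwise form in which the
    limit enters.\<close>
  have lim_scat': "\<forall>q2 \<in> {0..2*pi}. \<forall>q3 \<in> {0..2*pi}. \<forall>e lz l.
          e > 1 \<and> \<bar>lz\<bar> < l \<and> l > lam_c e \<longrightarrow>
          ((\<lambda>G. Fs (G, q2, q3, e, lz, l)) \<longlongrightarrow> fm e) at_bot"
  proof (intro ballI allI impI tendstoI)
    fix q2 q3 e lz l d :: real
    assume *: "q2 \<in> {0..2*pi}" "q3 \<in> {0..2*pi}" "e > 1 \<and> \<bar>lz\<bar> < l \<and> l > lam_c e" "d > 0"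
    then have "e > 1" by simp
    from fp[OF this \<open>d > 0\<close>] show "\<forall>\<^sub>F G in at_bot. dist (Fs (G, q2, q3, e, lz, l)) (fm e) < d"
      by eventually_elim (use * in \<open>simp add: dist_real_def\<close>)
  qed
  \<comment> \<open>One statement for weights of at most quadratic growth covers both observables:
    the current has a linear weight, the stress tensor a quadratic one.\<close>
  have lim: "((\<lambda>t. delta_int M m rs ths (\<lambda>p. w p * fsol Fa Fs M m t rs ths phs p)) \<longlongrightarrow>
      delta_int M m rs ths (\<lambda>p. w p * fstat fm M m rs ths p)) at_top"
    if "w \<in> borel_measurable borel" "\<And>p. \<bar>w p\<bar> \<le> c * (1 + norm p)\<^sup>2" for w c
  proof (rule delta_int_tendsto[OF M_pos rs_gt m_pos ths_gt ths_lt b_pos that])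
    show "fsol Fa Fs M m t rs ths phs \<in> borel_measurable borel" if "t \<ge> 0" for t
      by (rule borel_measurable_fsol[OF M_pos rs_gt that ths_gt ths_lt meas_abs meas_scat])
    show "\<bar>fsol Fa Fs M m t rs ths phs p\<bar> \<le> C * exp (- b * eps_of m p)" if "t \<ge> 0" for t p
      by (rule fsol_bounds[OF M_pos rs_gt that ths_gt ths_lt C_pos bd_abs bd_scat])
    show "((\<lambda>t. fsol Fa Fs M m t rs ths phs p) \<longlongrightarrow> fstat fm M m rs ths p) at_top" for p
      by (rule fsol_tendsto[OF M_pos rs_gt ths_gt ths_lt per_abs per_scat lim_abs lim_scat'])
  qed (auto simp: fsol_def fstat_def in_Gacc_def Let_def)
  fix a c :: 4
  define X where "X = frame M rs ths a"
  define Y where "Y = frame M rs ths c"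
  have inner_le: "\<bar>p \<bullet> Z\<bar> \<le> norm Z * (1 + norm p)" for p Z :: "real^4"
    using Cauchy_Schwarz_ineq2[of p Z] by (simp add: algebra_simps add_increasing)
  have "norm Z * (1 + norm p) \<le> norm Z * (1 + norm p)\<^sup>2" for p Z :: "real^4"
    by (intro mult_left_mono self_le_power) auto
  then have "\<bar>p \<bullet> X\<bar> \<le> norm X * (1 + norm p)\<^sup>2" for p
    using inner_le[of p X] order_trans by blast
  then show "((\<lambda>t. obsJ (fsol Fa Fs M m t rs ths phs) M m rs ths (frame M rs ths a))
        \<longlongrightarrow> obsJ (fstat fm M m rs ths) M m rs ths (frame M rs ths a)) at_top"
    unfolding obsJ_def X_def[symmetric] by (intro lim) auto
  have "\<bar>(p \<bullet> X) * (p \<bullet> Y)\<bar> \<le> norm X * norm Y * (1 + norm p)\<^sup>2" for p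
    using mult_mono[OF inner_le[of p X] inner_le[of p Y]]
    by (simp add: abs_mult power2_eq_square mult_ac)
  then show "((\<lambda>t. obsT (fsol Fa Fs M m t rs ths phs) M m rs ths (frame M rs ths a) (frame M rs ths c))
        \<longlongrightarrow> obsT (fstat fm M m rs ths) M m rs ths (frame M rs ths a) (frame M rs ths c)) at_top"
    unfolding obsT_def X_def[symmetric] Y_def[symmetric] by (intro lim) auto
qed

end
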